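(* Let $(\mathcal{M},\langle\cdot,\cdot\rangle)$ be a Riemannian manifold and let $\alpha:\mathcal{M}\to\mathbb{R}$ be a function of class $C^2$ with positive values. Then $\alpha$ is self-convex if and only if $$2\alpha(x)D^2\alpha(x)(\dot x,\dot x)+\|D\alpha(x)\|_x^2\,\|\dot x\|_x^2-4(D\alpha(x)\dot x)^2\ge 0$$ for any $x\in\mathcal{M}$ and for any vector $\dot x\in T_x\mathcal{M}$.
   Context: $D\alpha(x)$ is the first derivative and $D^2\alpha(x)$ the second covariant derivative (Riemannian Hessian) with respect to the original metric $\langle\cdot,\cdot\rangle$; thus $D^2\alpha(x)(\dot x,\dot x)=(\alpha\circ\gamma)''(0)$ for the geodesic $\gamma$ of $\mathcal{M}$ with $\gamma(0)=x$, $\gamma'(0)=\dot x$. $\|\cdot\|_x$ is the norm on $T_x\mathcal{M}$ (and its dual norm) given by $\langle\cdot,\cdot\rangle_x$. Self-convexity: let $\mathcal{M}_\kappa$ be $\mathcal{M}$ with the new metric $\langle\cdot,\cdot\rangle_{\kappa,x}=\alpha(x)\langle\cdot,\cdot\rangle_x$. The function $\alpha$ is self-convex when $t\mapsto\log\alpha(\gamma(t))$ is convex for every geodesic $\gamma$ in $\mathcal{M}_\kappa$. *)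

theory Defs
  imports "HOL-Analysis.Analysis"
begin

section \<open>Maps of class \<open>C\<^sup>k\<close> on open subsets of Euclidean spaces\<close>

text \<open>Meant for open \<open>S\<close> and a finite-dimensional domain: all iterated directional derivatives
  up to order \<open>k\<close> exist, are differentiable below order \<open>k\<close>, and are continuous.\<close>

primrec Ck_on ::
  "nat \<Rightarrow> 'e::euclidean_space set \<Rightarrow> ('e \<Rightarrow> 'f::real_normed_vector) \<Rightarrow> bool" where
  "Ck_on 0 S f \<longleftrightarrow> continuous_on S f"
| "Ck_on (Suc k) S f \<longleftrightarrow>
     (\<forall>p\<in>S. f differentiable (at p)) \<and>
     (\<forall>v. Ck_on k S (\<lambda>p. frechet_derivative f (at p) v))"

definition smooth_on ::
  "'e::euclidean_space set \<Rightarrow> ('e \<Rightarrow> 'f::real_normed_vector) \<Rightarrow> bool" where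
  "smooth_on S f \<longleftrightarrow> (\<forall>k. Ck_on k S f)"


section \<open>Smooth manifolds\<close>

text \<open>A chart is a domain together with a coordinate map; only the values of the map on the
  domain are relevant.\<close>

type_synonym ('a, 'e) chart = "'a set \<times> ('a \<Rightarrow> 'e)"

abbreviation cdom :: "('a, 'e) chart \<Rightarrow> 'a set" where "cdom c \<equiv> fst c"

abbreviation cmap :: "('a, 'e) chart \<Rightarrow> 'a \<Rightarrow> 'e" where "cmap c \<equiv> snd c"

abbreviation cran :: "('a, 'e) chart \<Rightarrow> 'e set" where "cran c \<equiv> cmap c ` cdom c"

abbreviation cinv :: "('a, 'e) chart \<Rightarrow> 'e \<Rightarrow> 'a" where "cinv c \<equiv> inv_into (cdom c) (cmap c)"

definition smooth_manifold ::
  "'a topology \<Rightarrow> ('a, 'e::euclidean_space) chart set \<Rightarrow> bool" where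
  "smooth_manifold X A \<longleftrightarrow>
     Hausdorff_space X \<and> second_countable X \<and>
     topspace X = (\<Union>c\<in>A. cdom c) \<and>
     (\<forall>c\<in>A. openin X (cdom c) \<and> open (cran c) \<and>
        homeomorphic_map (subtopology X (cdom c)) (top_of_set (cran c)) (cmap c)) \<and>
     (\<forall>c\<in>A. \<forall>d\<in>A. smooth_on (cmap c ` (cdom c \<inter> cdom d)) (cmap d \<circ> cinv c))"

definition charts_at :: "('a, 'e) chart set \<Rightarrow> 'a \<Rightarrow> ('a, 'e) chart set" where
  "charts_at A x = {c \<in> A. x \<in> cdom c}"


section \<open>Tangent vectors\<close>

text \<open>A tangent vector at \<open>x\<close> is the family of its coordinate vectors in all the charts at \<open>x\<close>,
  which transform by the derivatives of the transition maps. The value at every other chart is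
  set to \<open>0\<close>, so that equality of tangent vectors is equality of functions.\<close>

type_synonym ('a, 'e) tvec = "('a, 'e) chart \<Rightarrow> 'e"

definition tangent_space ::
  "('a, 'e::euclidean_space) chart set \<Rightarrow> 'a \<Rightarrow> ('a, 'e) tvec set" where
  "tangent_space A x =
     {v. (\<forall>c\<in>charts_at A x. \<forall>d\<in>charts_at A x.
            v d = frechet_derivative (cmap d \<circ> cinv c) (at (cmap c x)) (v c)) \<and>
         (\<forall>c. c \<notin> charts_at A x \<longrightarrow> v c = 0)}"

definition coord_vec ::
  "('a, 'e::euclidean_space) chart set \<Rightarrow> ('a, 'e) chart \<Rightarrow> 'a \<Rightarrow> 'e \<Rightarrow> ('a, 'e) tvec" where
  "coord_vec A c x u =
     (\<lambda>d. if d \<in> charts_at A x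
          then frechet_derivative (cmap d \<circ> cinv c) (at (cmap c x)) u else 0)"


section \<open>Riemannian metrics\<close>

type_synonym ('a, 'e) metric = "'a \<Rightarrow> ('a, 'e) tvec \<Rightarrow> ('a, 'e) tvec \<Rightarrow> real"

definition coord_metric ::
  "('a, 'e::euclidean_space) chart set \<Rightarrow> ('a, 'e) metric \<Rightarrow> ('a, 'e) chart
     \<Rightarrow> 'e \<Rightarrow> 'e \<Rightarrow> 'e \<Rightarrow> real" where
  "coord_metric A g c p u v =
     g (cinv c p) (coord_vec A c (cinv c p) u) (coord_vec A c (cinv c p) v)"

definition riemannian_manifold ::
  "'a topology \<Rightarrow> ('a, 'e::euclidean_space) chart set \<Rightarrow> ('a, 'e) metric \<Rightarrow> bool" where
  "riemannian_manifold X A g \<longleftrightarrow>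
     smooth_manifold X A \<and>
     (\<forall>x\<in>topspace X.
        (\<forall>u\<in>tangent_space A x. \<forall>v\<in>tangent_space A x. g x u v = g x v u) \<and>
        (\<forall>u\<in>tangent_space A x. \<forall>v\<in>tangent_space A x. \<forall>w\<in>tangent_space A x. \<forall>a b.
           g x (\<lambda>c. a *\<^sub>R u c + b *\<^sub>R v c) w = a * g x u w + b * g x v w) \<and>
        (\<forall>v\<in>tangent_space A x. v \<noteq> (\<lambda>c. 0) \<longrightarrow> g x v v > 0)) \<and>
     (\<forall>c\<in>A. \<forall>u v. smooth_on (cran c) (\<lambda>p. coord_metric A g c p u v))"

definition metric_norm :: "('a, 'e) metric \<Rightarrow> 'a \<Rightarrow> ('a, 'e) tvec \<Rightarrow> real" where
  "metric_norm g x v = sqrt (g x v v)"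

definition dual_norm ::
  "('a, 'e::euclidean_space) chart set \<Rightarrow> ('a, 'e) metric \<Rightarrow> 'a
     \<Rightarrow> (('a, 'e) tvec \<Rightarrow> real) \<Rightarrow> real" where
  "dual_norm A g x \<omega> = (SUP v \<in> {v \<in> tangent_space A x. metric_norm g x v \<le> 1}. \<bar>\<omega> v\<bar>)"


section \<open>Geodesics\<close>

text \<open>\<open>christoffel G p u v\<close> is the vector with components
  \<open>\<Sum>i j. \<Gamma>\<^sup>k\<^sub>i\<^sub>j(p) u\<^sup>i v\<^sup>j\<close>, where the Christoffel symbols of the coordinate
  metric \<open>G\<close> are determined by
  \<open>2 \<Sum>k. G\<^sub>k\<^sub>l \<Gamma>\<^sup>k\<^sub>i\<^sub>j = \<partial>\<^sub>i G\<^sub>j\<^sub>l + \<partial>\<^sub>j G\<^sub>i\<^sub>l - \<partial>\<^sub>l G\<^sub>i\<^sub>j\<close>.\<close>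

definition christoffel ::
  "('e::euclidean_space \<Rightarrow> 'e \<Rightarrow> 'e \<Rightarrow> real) \<Rightarrow> 'e \<Rightarrow> 'e \<Rightarrow> 'e \<Rightarrow> 'e" where
  "christoffel G p u v =
     (THE w. \<forall>z. 2 * G p w z =
          frechet_derivative (\<lambda>q. G q v z) (at p) u
        + frechet_derivative (\<lambda>q. G q u z) (at p) v
        - frechet_derivative (\<lambda>q. G q u v) (at p) z)"

text \<open>The geodesic equation \<open>y'' + \<Gamma>(y)(y', y') = 0\<close> for the coordinate curve \<open>y\<close>, in every chart.
  It makes sense for metrics that are merely \<open>C\<^sup>1\<close>. Constant curves are geodesics.\<close>

definition geodesic ::
  "'a topology \<Rightarrow> ('a, 'e::euclidean_space) chart set \<Rightarrow> ('a, 'e) metric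
     \<Rightarrow> real set \<Rightarrow> (real \<Rightarrow> 'a) \<Rightarrow> bool" where
  "geodesic X A g I \<gamma> \<longleftrightarrow>
     open I \<and> is_interval I \<and>
     continuous_map (top_of_set I) X \<gamma> \<and>
     (\<forall>t\<in>I. \<forall>c\<in>charts_at A (\<gamma> t).
        let y = cmap c \<circ> \<gamma>; y' = (\<lambda>s. vector_derivative y (at s)) in
          y differentiable (at t) \<and>
          (y' has_vector_derivative
             - christoffel (coord_metric A g c) (y t) (y' t) (y' t)) (at t))"


section \<open>Differential and Riemannian Hessian of a function\<close>

definition C2_function ::
  "('a, 'e::euclidean_space) chart set \<Rightarrow> ('a \<Rightarrow> real) \<Rightarrow> bool" where
  "C2_function A f \<longleftrightarrow> (\<forall>c\<in>A. Ck_on 2 (cran c) (f \<circ> cinv c))"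

text \<open>The differential and the Hessian at \<open>x\<close> are evaluated in one chart at \<open>x\<close>; being tensorial,
  they do not depend on which one.\<close>

definition chart_at :: "('a, 'e) chart set \<Rightarrow> 'a \<Rightarrow> ('a, 'e) chart" where
  "chart_at A x = (SOME c. c \<in> charts_at A x)"

definition differential ::
  "('a, 'e::euclidean_space) chart set \<Rightarrow> ('a \<Rightarrow> real) \<Rightarrow> 'a \<Rightarrow> ('a, 'e) tvec \<Rightarrow> real" where
  "differential A f x v =
     (let c = chart_at A x in frechet_derivative (f \<circ> cinv c) (at (cmap c x)) (v c))"

text \<open>In coordinates, \<open>D\<^sup>2f(u, v) = \<Sum>i j. (\<partial>\<^sub>i\<partial>\<^sub>j f - \<Sum>k. \<Gamma>\<^sup>k\<^sub>i\<^sub>j \<partial>\<^sub>k f) u\<^sup>i v\<^sup>j\<close>.\<close>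

definition hessian ::
  "('a, 'e::euclidean_space) chart set \<Rightarrow> ('a, 'e) metric \<Rightarrow> ('a \<Rightarrow> real)
     \<Rightarrow> 'a \<Rightarrow> ('a, 'e) tvec \<Rightarrow> ('a, 'e) tvec \<Rightarrow> real" where
  "hessian A g f x u v =
     (let c = chart_at A x; F = f \<circ> cinv c; p = cmap c x in
        frechet_derivative (\<lambda>q. frechet_derivative F (at q) (v c)) (at p) (u c)
      - frechet_derivative F (at p) (christoffel (coord_metric A g c) p (u c) (v c)))"


section \<open>Self-convexity\<close>

definition conformal_metric :: "('a \<Rightarrow> real) \<Rightarrow> ('a, 'e) metric \<Rightarrow> ('a, 'e) metric" where
  "conformal_metric \<alpha> g = (\<lambda>x u v. \<alpha> x * g x u v)"

definition self_convex ::
  "'a topology \<Rightarrow> ('a, 'e::euclidean_space) chart set \<Rightarrow> ('a, 'e) metric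
     \<Rightarrow> ('a \<Rightarrow> real) \<Rightarrow> bool" where
  "self_convex X A g \<alpha> \<longleftrightarrow>
     (\<forall>I \<gamma>. geodesic X A (conformal_metric \<alpha> g) I \<gamma> \<longrightarrow>
        convex_on I (\<lambda>t. ln (\<alpha> (\<gamma> t))))"

end

theory Submission
  imports Defs "HOL-Complex_Analysis.Great_Picard"
begin

text \<open>Fix a geodesic \<open>\<gamma>\<close> of the conformal metric \<open>\<alpha> g\<close> and put \<open>x = \<gamma> t\<close>, \<open>v = \<gamma>' t\<close>. The
  expression in the theorem, called \<open>convexity_form x v\<close> below, is \<open>2 \<alpha>(x)\<^sup>2\<close> times the second
  derivative of \<open>ln \<circ> \<alpha> \<circ> \<gamma>\<close> at \<open>t\<close>. To see this, let \<open>a\<close>, \<open>G\<close>, \<open>\<Gamma>\<close> be \<open>\<alpha>\<close>, \<open>g\<close> and the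
  Christoffel symbols of \<open>g\<close> in a chart, and let \<open>n\<close> be the \<open>G\<close>-gradient of \<open>a\<close>. The Christoffel
  symbols of \<open>a G\<close> are
  \<open>\<Gamma>\<^sub>a(u, u) = \<Gamma>(u, u) + (Da u / a) u - (G(u, u) / (2 a)) n\<close>
  (lemma \<open>conformal_christoffel\<close>). Differentiating \<open>Da(y)(y') / a(y)\<close> along a coordinate curve
  \<open>y\<close> with \<open>y'' = - \<Gamma>\<^sub>a(y', y')\<close> gives
  \<open>(2 a D\<^sup>2a(u, u) + G(n, n) G(u, u) - 4 (Da u)\<^sup>2) / (2 a\<^sup>2)\<close> with \<open>u = y'\<close>, where \<open>D\<^sup>2a\<close> is the
  Hessian of \<open>g\<close> (lemma \<open>ln_second_derivative_along_geodesic\<close>); and \<open>G(n, n)\<close> is the square of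
  the dual norm of \<open>Da\<close> by the Cauchy-Schwarz inequality.

  If the form is nonnegative, then \<open>ln \<circ> \<alpha> \<circ> \<gamma>\<close> has a nonnegative second derivative along every
  geodesic and is therefore convex. Conversely, convexity along geodesics yields the inequality at
  the pairs \<open>(\<gamma> t, \<gamma>' t)\<close>, so that every tangent vector has to be the velocity of some geodesic
  defined on an open interval around the parameter in question. This local existence is the
  longer part of the proof. Since \<open>\<Gamma>\<^sub>a\<close> is continuous, Peano's theorem provides a solution of the
  geodesic equation in one chart. A curve is a geodesic only if it solves the equation in every chart that it meets, so the
  transformation law \<open>D\<phi>(\<Gamma>(u, u)) = \<Gamma>'(D\<phi> u, D\<phi> u) + D\<^sup>2\<phi>(u, u)\<close> under chart changes \<open>\<phi>\<close> is
  needed; it follows from \<open>G(u, v) = G'(D\<phi> u, D\<phi> v)\<close> by differentiation and from the symmetry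
  of \<open>D\<^sup>2\<phi>\<close>.\<close>

section \<open>Existence of solutions of ordinary differential equations\<close>

lemma antiderivative_with_value:
  fixes h :: "real \<Rightarrow> 'z::euclidean_space"
  assumes "continuous_on {a..b} h" "c \<in> {a..b}"
  obtains Z where "Z c = z0"
    "\<And>t. t \<in> {a..b} \<Longrightarrow> (Z has_vector_derivative h t) (at t within {a..b})"
proof -
  obtain Y where Y: "\<And>t. t \<in> {a..b} \<Longrightarrow> (Y has_vector_derivative h t) (at t within {a..b})"
    using antiderivative_continuous[OF assms(1)] by blast
  have "((\<lambda>s. Y s - Y c + z0) has_vector_derivative h t) (at t within {a..b})"
    if "t \<in> {a..b}" for t
    using Y[OF that] by (auto intro!: derivative_eq_intros)
  then show ?thesis
    by (intro that[of "\<lambda>s. Y s - Y c + z0"]) auto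
qed

lemma has_vector_derivative_equal:
  fixes f g :: "real \<Rightarrow> 'z::real_normed_vector"
  assumes "convex S" "c \<in> S" "f c = g c"
    and "\<And>t. t \<in> S \<Longrightarrow> (f has_vector_derivative h t) (at t within S)"
    and "\<And>t. t \<in> S \<Longrightarrow> (g has_vector_derivative h t) (at t within S)"
    and "t \<in> S"
  shows "f t = g t"
proof -
  have "((\<lambda>s. f s - g s) has_derivative (\<lambda>h. 0)) (at t within S)" if "t \<in> S" for t
    using has_vector_derivative_diff[OF assms(4)[OF that] assms(5)[OF that]]
    by (simp add: has_vector_derivative_def)
  from has_derivative_zero_constant[OF \<open>convex S\<close> this]
  obtain k where "\<And>t. t \<in> S \<Longrightarrow> f t - g t = k"
    by blast
  from this[OF \<open>c \<in> S\<close>] this[OF \<open>t \<in> S\<close>] show ?thesis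
    using \<open>f c = g c\<close> by simp
qed

text \<open>Moves \<open>t\<close> towards \<open>0\<close> by \<open>\<delta>\<close>, stopping at \<open>0\<close>. An equation whose right-hand side is
  evaluated at the delayed time can be solved step by step, forwards and backwards from \<open>0\<close>.\<close>

definition delay :: "real \<Rightarrow> real \<Rightarrow> real" where
  "delay \<delta> t = max (min 0 (t + \<delta>)) (t - \<delta>)"

text \<open>Tonelli's construction. A function that solves the delayed equation for \<open>\<bar>t\<bar> \<le> k \<delta>\<close> determines,
  by one integration, a function that solves it for \<open>\<bar>t\<bar> \<le> (k + 1) \<delta>\<close>. The Lipschitz bound is
  part of the induction because it keeps the functions in the ball on which \<open>K\<close> is defined.\<close>

lemma delayed_solution_exists:
  fixes K :: "'z::euclidean_space \<Rightarrow> 'z"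
  assumes K: "continuous_on (cball z0 r) K" and M: "\<And>z. z \<in> cball z0 r \<Longrightarrow> norm (K z) \<le> M"
    and "M > 0" "T \<ge> 0" "M * T \<le> r" "\<delta> > 0"
  shows "\<exists>Z. Z 0 = z0 \<and> (\<forall>s\<in>{-T..T}. \<forall>t\<in>{-T..T}. norm (Z s - Z t) \<le> M * \<bar>s - t\<bar>) \<and>
    (\<forall>t\<in>{-T..T}. \<bar>t\<bar> \<le> real k * \<delta> \<longrightarrow>
       (Z has_vector_derivative K (Z (delay \<delta> t))) (at t within {-T..T} \<inter> {-(real k * \<delta>)..real k * \<delta>}))"
proof (induction k)
  case 0
  have "(\<lambda>t. z0) 0 = z0 \<and> (\<forall>s\<in>{-T..T}. \<forall>t\<in>{-T..T}. norm (z0 - z0) \<le> M * \<bar>s - t\<bar>) \<and>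
    (\<forall>t\<in>{-T..T}. \<bar>t\<bar> \<le> real 0 * \<delta> \<longrightarrow>
       ((\<lambda>t. z0) has_vector_derivative K z0) (at t within {-T..T} \<inter> {-(real 0 * \<delta>)..real 0 * \<delta>}))"
    using assms(3,4) by (auto simp: has_vector_derivative_def has_derivative_within bounded_linear_scaleR_left at_within_def)
  then show ?case by (intro exI[of _ "\<lambda>t. z0"]) simp
next
  case (Suc k)
  let ?I = "{-T..T}" and ?J = "\<lambda>k. {-(real k * \<delta>)..real k * \<delta>}"
  obtain Z where Z0: "Z 0 = z0"
    and ZL: "\<And>s t. s \<in> ?I \<Longrightarrow> t \<in> ?I \<Longrightarrow> norm (Z s - Z t) \<le> M * \<bar>s - t\<bar>"
    and ZD: "\<And>t. t \<in> ?I \<Longrightarrow> \<bar>t\<bar> \<le> real k * \<delta> \<Longrightarrow>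
       (Z has_vector_derivative K (Z (delay \<delta> t))) (at t within ?I \<inter> ?J k)"
    using Suc by blast
  have delay: "delay \<delta> t \<in> ?I" if "t \<in> ?I" for t
    using that \<open>\<delta> > 0\<close> by (auto simp: delay_def max_def min_def)
  have "0 \<in> ?I" using \<open>T \<ge> 0\<close> by simp
  have ball: "Z t \<in> cball z0 r" if "t \<in> ?I" for t
  proof -
    have "norm (Z 0 - Z t) \<le> M * \<bar>0 - t\<bar>" by (rule ZL) (use that \<open>0 \<in> ?I\<close> in auto)
    also have "\<dots> \<le> M * T" using that \<open>M > 0\<close> by (auto intro!: mult_left_mono)
    finally show ?thesis using \<open>M * T \<le> r\<close> by (simp add: Z0 dist_norm)
  qed
  have contZ: "continuous_on ?I Z"
    unfolding continuous_on_iff dist_norm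
  proof (intro ballI allI impI)
    fix t and e :: real assume "t \<in> ?I" "e > 0"
    moreover have "norm (Z s - Z t) < e" if "s \<in> ?I" "t \<in> ?I" "norm (s - t) < e / M" for s
    proof -
      have "norm (Z s - Z t) \<le> M * \<bar>s - t\<bar>" using ZL that by blast
      also have "\<dots> < e" using that(3) \<open>M > 0\<close> by (simp add: field_simps)
      finally show ?thesis .
    qed
    ultimately show "\<exists>d>0. \<forall>s\<in>?I. norm (s - t) < d \<longrightarrow> norm (Z s - Z t) < e"
      using \<open>M > 0\<close> by (intro exI[of _ "e / M"]) auto
  qed
  have "continuous_on ?I (\<lambda>t. K (Z (delay \<delta> t)))"
    by (rule continuous_on_compose2[OF K] continuous_on_compose2[OF contZ])+
       (use ball delay in \<open>auto simp: delay_def intro!: continuous_intros\<close>)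
  then obtain Y where Y0: "Y 0 = z0"
    and YD: "\<And>t. t \<in> ?I \<Longrightarrow> (Y has_vector_derivative K (Z (delay \<delta> t))) (at t within ?I)"
    using antiderivative_with_value[OF _ \<open>0 \<in> ?I\<close>] by metis
  have YL: "norm (Y s - Y t) \<le> M * \<bar>s - t\<bar>" if "s \<in> ?I" "t \<in> ?I" for s t
  proof -
    have "norm (Y s - Y t) \<le> M * norm (s - t)"
    proof (rule differentiable_bound[of ?I])
      show "(Y has_derivative (\<lambda>h. h *\<^sub>R K (Z (delay \<delta> t)))) (at t within ?I)" if "t \<in> ?I" for t
        using YD[OF that] by (simp add: has_vector_derivative_def)
      show "onorm (\<lambda>h. h *\<^sub>R K (Z (delay \<delta> t))) \<le> M" if "t \<in> ?I" for t
        using M[OF ball[OF delay[OF that]]]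
        by (intro onorm_le) (simp add: mult.commute[of M] mult_left_mono)
    qed (use that in auto)
    then show ?thesis by simp
  qed
  have same: "Y t = Z t" if "t \<in> ?I \<inter> ?J k" for t
  proof (rule has_vector_derivative_equal[of "?I \<inter> ?J k" 0])
    show "(Y has_vector_derivative K (Z (delay \<delta> t))) (at t within ?I \<inter> ?J k)"
      if "t \<in> ?I \<inter> ?J k" for t
      using YD that by (meson IntD1 has_vector_derivative_within_subset inf_le1)
  qed (use ZD that Y0 Z0 \<open>T \<ge> 0\<close> \<open>\<delta> > 0\<close> in \<open>auto simp: convex_Int\<close>)
  have "Y (delay \<delta> t) = Z (delay \<delta> t)" if "t \<in> ?I" "\<bar>t\<bar> \<le> real (Suc k) * \<delta>" for t
  proof (rule same)
    have "\<bar>delay \<delta> t\<bar> \<le> max 0 (\<bar>t\<bar> - \<delta>)"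
      using \<open>\<delta> > 0\<close> by (auto simp: delay_def max_def min_def)
    also have "\<dots> \<le> real k * \<delta>"
      using that(2) \<open>\<delta> > 0\<close> by (auto simp: algebra_simps)
    finally show "delay \<delta> t \<in> ?I \<inter> ?J k" using delay[OF that(1)] by auto
  qed
  then have "(Y has_vector_derivative K (Y (delay \<delta> t))) (at t within ?I \<inter> ?J (Suc k))"
    if "t \<in> ?I" "\<bar>t\<bar> \<le> real (Suc k) * \<delta>" for t
    using YD[OF that(1)] that by (metis has_vector_derivative_within_subset inf_le1)
  then show ?case
    using Y0 YL by blast
qed

text \<open>The solutions of the delayed equations are equicontinuous, so that by the Arzela-Ascoli theorem
  some sequence of them with delays tending to \<open>0\<close> converges uniformly. Their derivatives then
  converge uniformly as well, and the limit solves the equation without delay.\<close>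

theorem Peano_existence:
  fixes K :: "'z::euclidean_space \<Rightarrow> 'z"
  assumes "open W" "z0 \<in> W" "continuous_on W K"
  obtains T z where "T > 0" "z 0 = z0"
    "\<And>t. t \<in> {-T<..<T} \<Longrightarrow> z t \<in> W"
    "\<And>t. t \<in> {-T<..<T} \<Longrightarrow> (z has_vector_derivative K (z t)) (at t)"
proof -
  obtain r where r: "r > 0" "cball z0 r \<subseteq> W"
    using assms open_contains_cball by blast
  have contK: "continuous_on (cball z0 r) K"
    using assms(3) r(2) continuous_on_subset by blast
  then have "bounded (K ` cball z0 r)"
    by (intro compact_imp_bounded compact_continuous_image) auto
  then obtain M where M: "M > 0" "\<And>z. z \<in> cball z0 r \<Longrightarrow> norm (K z) \<le> M"
    unfolding bounded_pos by blast
  (* An M-Lipschitz curve starting in z0 does not leave the ball within time T. *)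
  define T where "T = r / M"
  have T: "T > 0" "M * T = r" using r M by (auto simp: T_def)
  let ?I = "{-T..T}"
  (* With this delay, n + 1 steps of the construction reach the whole interval. *)
  define \<delta> where "\<delta> n = T / real (Suc n)" for n
  have \<delta>: "\<delta> n > 0" "real (Suc n) * \<delta> n = T" for n
    using T by (auto simp: \<delta>_def)
  have \<delta>_lim: "\<delta> \<longlonglongrightarrow> 0"
    unfolding \<delta>_def using LIMSEQ_Suc[OF lim_const_over_n[of T]] by simp
  have "\<exists>Z. Z 0 = z0 \<and> (\<forall>s\<in>?I. \<forall>t\<in>?I. norm (Z s - Z t) \<le> M * \<bar>s - t\<bar>) \<and>
    (\<forall>t\<in>?I. (Z has_vector_derivative K (Z (delay (\<delta> n) t))) (at t within ?I))" for n
    using delayed_solution_exists[OF contK M(2) M(1), of T "\<delta> n" "Suc n"] T \<delta>[of n]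
    by (auto simp: abs_le_iff)
  then obtain Z where Z0: "\<And>n. Z n 0 = z0"
    and ZL: "\<And>n s t. s \<in> ?I \<Longrightarrow> t \<in> ?I \<Longrightarrow> norm (Z n s - Z n t) \<le> M * \<bar>s - t\<bar>"
    and ZD: "\<And>n t. t \<in> ?I \<Longrightarrow> (Z n has_vector_derivative K (Z n (delay (\<delta> n) t))) (at t within ?I)"
    by metis
  have delay: "delay (\<delta> n) t \<in> ?I" "\<bar>delay (\<delta> n) t - t\<bar> \<le> \<delta> n" if "t \<in> ?I" for n t
    using that \<delta>(1)[of n] by (auto simp: delay_def max_def min_def)
  have ball: "Z n t \<in> cball z0 r" if "t \<in> ?I" for n t
  proof -
    have "norm (Z n 0 - Z n t) \<le> M * \<bar>0 - t\<bar>" by (rule ZL) (use that T in auto)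
    also have "\<dots> \<le> M * T" using that M by (auto intro!: mult_left_mono)
    finally show ?thesis using T by (simp add: Z0 dist_norm)
  qed
  obtain z k where z: "strict_mono (k :: nat \<Rightarrow> nat)"
    and conv: "\<And>e. 0 < e \<Longrightarrow> \<exists>N. \<forall>n x. n \<ge> N \<and> x \<in> ?I \<longrightarrow> norm (Z (k n) x - z x) < e"
  proof (rule Arzela_Ascoli[of ?I Z "norm z0 + r"])
    show "norm (Z n t) \<le> norm z0 + r" if "t \<in> ?I" for n t
      using ball[OF that, of n] norm_triangle_ineq2[of "Z n t" z0]
      by (simp add: dist_norm norm_minus_commute)
    show "\<exists>d>0. \<forall>n y. y \<in> ?I \<and> norm (t - y) < d \<longrightarrow> norm (Z n t - Z n y) < e"
      if "t \<in> ?I" "0 < e" for t e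
    proof (intro exI[of _ "e / M"] conjI allI impI)
      fix n y assume y: "y \<in> ?I \<and> norm (t - y) < e / M"
      then have "norm (Z n t - Z n y) \<le> M * \<bar>t - y\<bar>" using ZL that by blast
      also have "\<dots> < e" using y M by (simp add: field_simps)
      finally show "norm (Z n t - Z n y) < e" .
    qed (use that M in auto)
  qed auto
  have lim: "(\<lambda>n. Z (k n) t) \<longlonglongrightarrow> z t" if "t \<in> ?I" for t
    unfolding LIMSEQ_iff using conv that by meson
  have zball: "z t \<in> cball z0 r" if "t \<in> ?I" for t
    by (rule closed_sequentially[OF closed_cball _ lim[OF that]]) (use ball[OF that] in blast)
  have unif: "uniformly_continuous_on (cball z0 r) K"
    by (rule compact_uniformly_continuous[OF contK compact_cball])
  have deriv_conv: "\<forall>\<^sub>F n in sequentially. \<forall>t\<in>?I. \<forall>h.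
      norm (h *\<^sub>R K (Z (k n) (delay (\<delta> (k n)) t)) - h *\<^sub>R K (z t)) \<le> e * norm h" if "e > 0" for e
  proof -
    obtain d where d: "d > 0" "\<And>x y. x \<in> cball z0 r \<Longrightarrow> y \<in> cball z0 r \<Longrightarrow> dist x y < d \<Longrightarrow> dist (K x) (K y) < e"
      using unif \<open>e > 0\<close> unfolding uniformly_continuous_on_def by metis
    obtain N where N: "\<And>n t. n \<ge> N \<Longrightarrow> t \<in> ?I \<Longrightarrow> norm (Z (k n) t - z t) < d / 2"
      using conv[of "d/2"] d(1) by auto
    have "(\<lambda>n. \<delta> (k n)) \<longlonglongrightarrow> 0"
      using LIMSEQ_subseq_LIMSEQ[OF \<delta>_lim z] by (simp add: o_def)
    then have "\<forall>\<^sub>F n in sequentially. \<delta> (k n) < d / (2 * M)"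
      by (rule order_tendstoD(2)) (use d M in auto)
    then show ?thesis using eventually_ge_at_top[of N]
    proof eventually_elim
      case (elim n)
      show ?case
      proof (intro ballI allI)
        fix t h assume t: "t \<in> ?I"
        let ?s = "delay (\<delta> (k n)) t"
        have "norm (Z (k n) ?s - Z (k n) t) \<le> M * \<bar>?s - t\<bar>"
          using ZL delay t by blast
        also have "\<dots> \<le> M * \<delta> (k n)" using delay(2)[OF t] M by (auto intro!: mult_left_mono)
        also have "\<dots> < d / 2" using elim(1) M by (simp add: field_simps)
        finally have "dist (Z (k n) ?s) (z t) < d"
          using N[OF elim(2) t] norm_triangle_ineq[of "Z (k n) ?s - Z (k n) t" "Z (k n) t - z t"]
          by (simp add: dist_norm)
        then have "norm (K (Z (k n) ?s) - K (z t)) \<le> e"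
          using d(2) ball zball delay t by (metis dist_norm less_imp_le)
        then show "norm (h *\<^sub>R K (Z (k n) ?s) - h *\<^sub>R K (z t)) \<le> e * norm h"
          by (simp add: mult.commute[of e] mult_left_mono flip: scaleR_right_diff_distrib)
      qed
    qed
  qed
  have "\<exists>g. \<forall>t\<in>?I. (\<lambda>n. Z (k n) t) \<longlonglongrightarrow> g t \<and>
      (g has_derivative (\<lambda>h. h *\<^sub>R K (z t))) (at t within ?I)"
  proof (rule has_derivative_sequence[OF _ _ deriv_conv])
    show "(Z (k n) has_derivative (\<lambda>h. h *\<^sub>R K (Z (k n) (delay (\<delta> (k n)) t)))) (at t within ?I)"
      if "t \<in> ?I" for n t
      using ZD[OF that] by (simp add: has_vector_derivative_def)
    show "(\<lambda>n. Z (k n) 0) \<longlonglongrightarrow> z0" by (simp add: Z0)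
  qed (use T in auto)
  then obtain g where g: "\<And>t. t \<in> ?I \<Longrightarrow> (\<lambda>n. Z (k n) t) \<longlonglongrightarrow> g t"
    "\<And>t. t \<in> ?I \<Longrightarrow> (g has_vector_derivative K (z t)) (at t within ?I)"
    unfolding has_vector_derivative_def by blast
  have gz: "g t = z t" if "t \<in> ?I" for t
    using LIMSEQ_unique[OF g(1) lim] that by blast
  have "(g has_vector_derivative K (g t)) (at t)" if "t \<in> {-T<..<T}" for t
  proof -
    have I: "t \<in> ?I" "{-T<..<T} \<subseteq> ?I" using that by auto
    have "(g has_vector_derivative K (g t)) (at t within {-T<..<T})"
      unfolding gz[OF I(1)] by (rule has_vector_derivative_within_subset[OF g(2)[OF I(1)] I(2)])
    then show ?thesis using that by (simp add: at_within_open[OF _ open_greaterThanLessThan])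
  qed
  moreover have "g 0 = z0"
    using LIMSEQ_unique[OF g(1)[of 0], of z0] T by (simp add: Z0)
  moreover have "g t \<in> W" if "t \<in> {-T<..<T}" for t
  proof -
    have "t \<in> ?I" using that by auto
    then show ?thesis using gz[of t] zball[of t] r(2) by auto
  qed
  ultimately show ?thesis using T(1) by (intro that[of T g])
qed

section \<open>Differentiation along curves and symmetry of second derivatives\<close>

lemma linear_Basis_expansion:
  fixes f :: "'e::euclidean_space \<Rightarrow> 'f::real_normed_vector"
  assumes "linear f"
  shows "f v = (\<Sum>b\<in>Basis. (v \<bullet> b) *\<^sub>R f b)"
  using linear_sum[OF assms, of "\<lambda>b. (v \<bullet> b) *\<^sub>R b" Basis]
  by (simp add: linear_cmul[OF assms] euclidean_representation)

text \<open>The product rule for a family \<open>L q\<close> of linear maps applied to a varying vector: expanding the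
  vector in the basis of the fibre reduces it to sums of products, and only the functions
  \<open>q \<mapsto> L q v\<close> for fixed \<open>v\<close> have to be differentiable. It serves for differentials, and, used
  twice, for bilinear forms.\<close>

lemma has_derivative_linear_family:
  fixes L :: "'y::real_normed_vector \<Rightarrow> 'e::euclidean_space \<Rightarrow> 'f::real_normed_vector"
  assumes "open U" "Y x \<in> U"
    and lin: "\<And>q. q \<in> U \<Longrightarrow> linear (L q)"
    and L': "\<And>v. ((\<lambda>q. L q v) has_derivative L' v) (at (Y x))"
    and Y: "(Y has_derivative Y') (at x)"
    and \<eta>: "(\<eta> has_derivative \<eta>') (at x)"
  shows "((\<lambda>s. L (Y s) (\<eta> s)) has_derivative (\<lambda>h. L' (\<eta> x) (Y' h) + L (Y x) (\<eta>' h))) (at x)"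
proof -
  have expand: "L q v = (\<Sum>b\<in>Basis. (v \<bullet> b) *\<^sub>R L q b)" if "q \<in> U" for q v
    by (rule linear_Basis_expansion[OF lin[OF that]])
  have expand': "L' v k = (\<Sum>b\<in>Basis. (v \<bullet> b) *\<^sub>R L' b k)" for v k
  proof -
    have "((\<lambda>q. \<Sum>b\<in>Basis. (v \<bullet> b) *\<^sub>R L q b) has_derivative
        (\<lambda>k. \<Sum>b\<in>Basis. (v \<bullet> b) *\<^sub>R L' b k)) (at (Y x))"
      by (intro derivative_intros L')
    then have "((\<lambda>q. L q v) has_derivative (\<lambda>k. \<Sum>b\<in>Basis. (v \<bullet> b) *\<^sub>R L' b k)) (at (Y x))"
      by (rule has_derivative_transform_within_open[OF _ assms(1,2)]) (simp add: expand[symmetric])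
    then show ?thesis
      using has_derivative_unique[OF L'] by metis
  qed
  have LY: "((\<lambda>s. L (Y s) v) has_derivative (\<lambda>h. L' v (Y' h))) (at x)" for v
    using has_derivative_compose[OF Y L'] .
  have "((\<lambda>s. \<Sum>b\<in>Basis. (\<eta> s \<bullet> b) *\<^sub>R L (Y s) b) has_derivative
      (\<lambda>h. \<Sum>b\<in>Basis. (\<eta> x \<bullet> b) *\<^sub>R L' b (Y' h) + (\<eta>' h \<bullet> b) *\<^sub>R L (Y x) b)) (at x)"
    by (intro derivative_intros \<eta> LY)
  then have *: "((\<lambda>s. \<Sum>b\<in>Basis. (\<eta> s \<bullet> b) *\<^sub>R L (Y s) b) has_derivative
      (\<lambda>h. L' (\<eta> x) (Y' h) + L (Y x) (\<eta>' h))) (at x)"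
    by (simp add: sum.distrib expand'[of "\<eta> x"] expand[OF assms(2), of "\<eta>' _"])
  have "(Y \<longlongrightarrow> Y x) (at x)"
    using has_derivative_continuous[OF Y] by (simp add: continuous_at)
  then have "\<forall>\<^sub>F s in at x. Y s \<in> U"
    using assms(1,2) by (rule topological_tendstoD)
  then have "\<forall>\<^sub>F s in at x. (\<Sum>b\<in>Basis. (\<eta> s \<bullet> b) *\<^sub>R L (Y s) b) = L (Y s) (\<eta> s)"
    by eventually_elim (simp add: expand[symmetric])
  then show ?thesis
    by (rule has_derivative_transform_eventually[OF *]) (simp_all add: expand[symmetric] assms(2))
qed

lemma continuous_on_linear_family:
  fixes L :: "'y::topological_space \<Rightarrow> 'e::euclidean_space \<Rightarrow> 'f::real_normed_vector"
  assumes lin: "\<And>q. q \<in> U \<Longrightarrow> linear (L q)"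
    and cont: "\<And>v. continuous_on U (\<lambda>q. L q v)"
    and Y: "continuous_on T Y" "\<And>s. s \<in> T \<Longrightarrow> Y s \<in> U" and \<eta>: "continuous_on T \<eta>"
  shows "continuous_on T (\<lambda>s. L (Y s) (\<eta> s))"
proof -
  have expand: "L q v = (\<Sum>b\<in>Basis. (v \<bullet> b) *\<^sub>R L q b)" if "q \<in> U" for q v
    by (rule linear_Basis_expansion[OF lin[OF that]])
  have "continuous_on T (\<lambda>s. \<Sum>b\<in>Basis. (\<eta> s \<bullet> b) *\<^sub>R L (Y s) b)"
    by (intro continuous_intros \<eta> continuous_on_compose2[OF cont Y(1)]) (use Y(2) in auto)
  then show ?thesis
    by (rule continuous_on_eq) (simp add: expand[symmetric] Y(2))
qed

lemma Ck_on_2D: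
  assumes "Ck_on 2 S f"
  shows "p \<in> S \<Longrightarrow> f differentiable (at p)"
    and "p \<in> S \<Longrightarrow> (\<lambda>q. frechet_derivative f (at q) u) differentiable (at p)"
    and "continuous_on S (\<lambda>q. frechet_derivative (\<lambda>r. frechet_derivative f (at r) u) (at q) v)"
  using assms by (auto simp: numeral_2_eq_2)

text \<open>The chain rule to second order along a curve with velocity \<open>u\<close> and acceleration \<open>w\<close>:
  \<open>(f \<circ> y)'' = D\<^sup>2f(u, u) + Df w\<close>.\<close>

lemma has_vector_derivative_differential_along:
  fixes f :: "'e::euclidean_space \<Rightarrow> 'f::real_normed_vector"
  assumes f: "Ck_on 2 S f" and "open S" "y t \<in> S"
    and y: "(y has_vector_derivative u) (at t)" and u: "(y' has_vector_derivative w) (at t)" "y' t = u"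
  shows "((\<lambda>s. f (y s)) has_vector_derivative frechet_derivative f (at (y t)) u) (at t)"
    and "((\<lambda>s. frechet_derivative f (at (y s)) (y' s)) has_vector_derivative
      frechet_derivative (\<lambda>q. frechet_derivative f (at q) u) (at (y t)) u
      + frechet_derivative f (at (y t)) w) (at t)"
proof -
  have df: "(f has_derivative frechet_derivative f (at q)) (at q)" if "q \<in> S" for q
    using Ck_on_2D(1)[OF f that] by (simp add: frechet_derivative_works)
  have d2f: "((\<lambda>q. frechet_derivative f (at q) v) has_derivative
      frechet_derivative (\<lambda>q. frechet_derivative f (at q) v) (at q)) (at q)" if "q \<in> S" for q v
    using Ck_on_2D(2)[OF f that] by (simp add: frechet_derivative_works)
  note lin = has_derivative_linear[OF df[OF \<open>y t \<in> S\<close>]]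
  show "((\<lambda>s. f (y s)) has_vector_derivative frechet_derivative f (at (y t)) u) (at t)"
    using has_derivative_compose[OF y[unfolded has_vector_derivative_def] df[OF \<open>y t \<in> S\<close>]]
    by (simp add: has_vector_derivative_def linear_cmul[OF lin])
  show "((\<lambda>s. frechet_derivative f (at (y s)) (y' s)) has_vector_derivative
      frechet_derivative (\<lambda>q. frechet_derivative f (at q) u) (at (y t)) u
      + frechet_derivative f (at (y t)) w) (at t)"
    using has_derivative_linear_family[OF assms(2,3) has_derivative_linear[OF df] d2f[OF \<open>y t \<in> S\<close>]
        y[unfolded has_vector_derivative_def] u(1)[unfolded has_vector_derivative_def]]
    by (simp add: has_vector_derivative_def linear_cmul[OF lin] u(2) scaleR_add_right
        linear_cmul[OF has_derivative_linear[OF d2f[OF \<open>y t \<in> S\<close>]]])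
qed

text \<open>The mean value theorem, applied first in the direction \<open>u\<close> and then in the direction \<open>v\<close>. The
  second difference is symmetric in \<open>u\<close> and \<open>v\<close>, whence the symmetry of second derivatives.\<close>

lemma second_difference_mean_value:
  fixes f :: "'e::euclidean_space \<Rightarrow> real"
  assumes f: "Ck_on 2 S f" and "h > 0"
    and S: "\<And>a b. 0 \<le> a \<Longrightarrow> a \<le> h \<Longrightarrow> 0 \<le> b \<Longrightarrow> b \<le> h \<Longrightarrow> p + a *\<^sub>R u + b *\<^sub>R v \<in> S"
  obtains a b where "0 \<le> a" "a \<le> h" "0 \<le> b" "b \<le> h"
    "f (p + h *\<^sub>R u + h *\<^sub>R v) - f (p + h *\<^sub>R u) - f (p + h *\<^sub>R v) + f p =
     h\<^sup>2 * frechet_derivative (\<lambda>r. frechet_derivative f (at r) u) (at (p + a *\<^sub>R u + b *\<^sub>R v)) v"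
proof -
  define D where "D q = frechet_derivative f (at q) u" for q
  have f_line: "((\<lambda>s. f (p + s *\<^sub>R u + b *\<^sub>R v)) has_real_derivative D (p + s *\<^sub>R u + b *\<^sub>R v)) (at s)"
    if "0 \<le> s" "s \<le> h" "0 \<le> b" "b \<le> h" for s b
  proof -
    have df: "(f has_derivative frechet_derivative f (at (p + s *\<^sub>R u + b *\<^sub>R v))) (at (p + s *\<^sub>R u + b *\<^sub>R v))"
      using Ck_on_2D(1)[OF f S[OF that]] by (simp add: frechet_derivative_works)
    have "((\<lambda>s. p + s *\<^sub>R u + b *\<^sub>R v) has_derivative (\<lambda>k. k *\<^sub>R u)) (at s)"
      by (auto intro!: derivative_eq_intros)
    from has_derivative_compose[OF this df] show ?thesis
      by (simp add: has_field_derivative_def D_def linear_cmul[OF has_derivative_linear[OF df]]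
          mult_commute_abs)
  qed
  have D_line: "((\<lambda>b. D (p + s *\<^sub>R u + b *\<^sub>R v)) has_real_derivative
      frechet_derivative D (at (p + s *\<^sub>R u + b *\<^sub>R v)) v) (at b)"
    if "0 \<le> s" "s \<le> h" "0 \<le> b" "b \<le> h" for s b
  proof -
    have dD: "(D has_derivative frechet_derivative D (at (p + s *\<^sub>R u + b *\<^sub>R v))) (at (p + s *\<^sub>R u + b *\<^sub>R v))"
      using Ck_on_2D(2)[OF f S[OF that], of u] unfolding D_def by (simp add: frechet_derivative_works)
    have "((\<lambda>b. p + s *\<^sub>R u + b *\<^sub>R v) has_derivative (\<lambda>k. k *\<^sub>R v)) (at b)"
      by (auto intro!: derivative_eq_intros)
    from has_derivative_compose[OF this dD] show ?thesis
      by (simp add: has_field_derivative_def linear_cmul[OF has_derivative_linear[OF dD]]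
          mult_commute_abs)
  qed
  define G where "G s = f (p + s *\<^sub>R u + h *\<^sub>R v) - f (p + s *\<^sub>R u)" for s
  have "(G has_real_derivative D (p + s *\<^sub>R u + h *\<^sub>R v) - D (p + s *\<^sub>R u)) (at s)"
    if "0 \<le> s" "s \<le> h" for s
    using DERIV_diff[OF f_line[OF that, of h] f_line[OF that, of 0]] \<open>h > 0\<close>
    by (simp add: G_def[abs_def])
  from MVT2[OF \<open>h > 0\<close> this] obtain a where a: "0 < a" "a < h"
    "G h - G 0 = h * (D (p + a *\<^sub>R u + h *\<^sub>R v) - D (p + a *\<^sub>R u))" by auto
  from MVT2[OF \<open>h > 0\<close> D_line[of a]] a(1,2) obtain b where b: "0 < b" "b < h"
    "D (p + a *\<^sub>R u + h *\<^sub>R v) - D (p + a *\<^sub>R u) = h * frechet_derivative D (at (p + a *\<^sub>R u + b *\<^sub>R v)) v"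
    by auto
  have "G h - G 0 = h\<^sup>2 * frechet_derivative D (at (p + a *\<^sub>R u + b *\<^sub>R v)) v"
    using a(3) b(3) by (simp add: power2_eq_square)
  then show ?thesis
    using a b by (intro that[of a b]) (auto simp: G_def D_def[abs_def])
qed

lemma second_derivative_symmetric_real:
  fixes f :: "'e::euclidean_space \<Rightarrow> real"
  assumes f: "Ck_on 2 S f" and "open S" "p \<in> S"
  shows "frechet_derivative (\<lambda>q. frechet_derivative f (at q) u) (at p) v =
         frechet_derivative (\<lambda>q. frechet_derivative f (at q) v) (at p) u"
proof -
  define H where "H u v q = frechet_derivative (\<lambda>r. frechet_derivative f (at r) u) (at q) v" for u v q
  have near: "\<exists>d>0. \<forall>q. dist q p < d \<longrightarrow> q \<in> S \<and> \<bar>H u v q - H u v p\<bar> < e" if "e > 0" for u v e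
  proof -
    have "continuous_on S (H u v)"
      unfolding H_def[abs_def] using Ck_on_2D(3)[OF f] .
    then obtain d1 where "d1 > 0" "\<And>q. q \<in> S \<Longrightarrow> dist q p < d1 \<Longrightarrow> \<bar>H u v q - H u v p\<bar> < e"
      using \<open>p \<in> S\<close> \<open>e > 0\<close> unfolding continuous_on_iff dist_real_def by metis
    moreover obtain d2 where "d2 > 0" "\<And>q. dist q p < d2 \<Longrightarrow> q \<in> S"
      using \<open>open S\<close> \<open>p \<in> S\<close> unfolding open_dist by metis
    ultimately show ?thesis
      by (intro exI[of _ "min d1 d2"]) auto
  qed
  have "\<bar>H u v p - H v u p\<bar> \<le> 0"
  proof (rule field_le_epsilon)
    fix e :: real assume "e > 0"
    then obtain d1 d2 where d1: "d1 > 0" "\<And>q. dist q p < d1 \<Longrightarrow> q \<in> S \<and> \<bar>H u v q - H u v p\<bar> < e/2"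
      and d2: "d2 > 0" "\<And>q. dist q p < d2 \<Longrightarrow> q \<in> S \<and> \<bar>H v u q - H v u p\<bar> < e/2"
      using near[of "e/2"] by (metis half_gt_zero)
    define d where "d = min d1 d2"
    (* The parallelogram with sides h u and h v then lies in the ball of radius d around p. *)
    define h where "h = d / (2 * (norm u + norm v + 1))"
    have pos: "norm u + norm v + 1 > 0" by (simp add: add_nonneg_pos)
    have h: "h > 0" using d1 d2 pos by (simp add: h_def d_def)
    have dist: "dist (p + a *\<^sub>R x + b *\<^sub>R y) p < d"
      if "0 \<le> a" "a \<le> h" "0 \<le> b" "b \<le> h" "norm x + norm y = norm u + norm v" for a b x y
    proof -
      have "dist (p + a *\<^sub>R x + b *\<^sub>R y) p \<le> a * norm x + b * norm y"
        using norm_triangle_ineq[of "a *\<^sub>R x" "b *\<^sub>R y"] that by (simp add: dist_norm algebra_simps)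
      also have "\<dots> \<le> h * norm x + h * norm y"
        by (intro add_mono mult_right_mono that) auto
      also have "\<dots> = h * (norm u + norm v)" by (simp add: that(5)[symmetric] algebra_simps)
      also have "\<dots> < h * (2 * (norm u + norm v + 1))"
        using h pos by (intro mult_strict_left_mono) auto
      also have "\<dots> = d" using pos by (simp add: h_def)
      finally show ?thesis .
    qed
    obtain a b where ab: "0 \<le> a" "a \<le> h" "0 \<le> b" "b \<le> h"
      "f (p + h *\<^sub>R u + h *\<^sub>R v) - f (p + h *\<^sub>R u) - f (p + h *\<^sub>R v) + f p = h\<^sup>2 * H u v (p + a *\<^sub>R u + b *\<^sub>R v)"
      using second_difference_mean_value[OF f h, of p u v, folded H_def] dist[of _ _ u v] d1(2)
      unfolding d_def by (metis min_less_iff_conj)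
    obtain a' b' where ab': "0 \<le> a'" "a' \<le> h" "0 \<le> b'" "b' \<le> h"
      "f (p + h *\<^sub>R v + h *\<^sub>R u) - f (p + h *\<^sub>R v) - f (p + h *\<^sub>R u) + f p = h\<^sup>2 * H v u (p + a' *\<^sub>R v + b' *\<^sub>R u)"
      using second_difference_mean_value[OF f h, of p v u, folded H_def] dist[of _ _ v u] d1(2)
      unfolding d_def by (metis min_less_iff_conj add.commute)
    have comm: "p + h *\<^sub>R v + h *\<^sub>R u = p + h *\<^sub>R u + h *\<^sub>R v" by simp
    have "h\<^sup>2 * H u v (p + a *\<^sub>R u + b *\<^sub>R v) = h\<^sup>2 * H v u (p + a' *\<^sub>R v + b' *\<^sub>R u)"
      using ab(5) ab'(5)[unfolded comm] by linarith
    then have "H u v (p + a *\<^sub>R u + b *\<^sub>R v) = H v u (p + a' *\<^sub>R v + b' *\<^sub>R u)"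
      using h by simp
    moreover have "\<bar>H u v (p + a *\<^sub>R u + b *\<^sub>R v) - H u v p\<bar> < e/2"
      using d1(2) dist[OF ab(1-4)] by (simp add: d_def)
    moreover have "\<bar>H v u (p + a' *\<^sub>R v + b' *\<^sub>R u) - H v u p\<bar> < e/2"
      using d2(2) dist[OF ab'(1-4)] by (simp add: d_def add.commute)
    ultimately show "\<bar>H u v p - H v u p\<bar> \<le> 0 + e" by linarith
  qed
  then show ?thesis by (simp add: H_def)
qed

lemma frechet_derivative_inner_left:
  fixes \<phi> :: "'e::real_normed_vector \<Rightarrow> 'f::real_inner"
  assumes "\<phi> differentiable (at p)"
  shows "(\<lambda>q. \<phi> q \<bullet> b) differentiable (at p)"
    and "frechet_derivative (\<lambda>q. \<phi> q \<bullet> b) (at p) u = frechet_derivative \<phi> (at p) u \<bullet> b"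
proof -
  have "((\<lambda>q. \<phi> q \<bullet> b) has_derivative (\<lambda>u. frechet_derivative \<phi> (at p) u \<bullet> b)) (at p)"
    using assms unfolding frechet_derivative_works by (intro derivative_intros)
  then show "(\<lambda>q. \<phi> q \<bullet> b) differentiable (at p)"
    "frechet_derivative (\<lambda>q. \<phi> q \<bullet> b) (at p) u = frechet_derivative \<phi> (at p) u \<bullet> b"
    using frechet_derivative_at by (fastforce simp: differentiable_def fun_eq_iff)+
qed

theorem second_derivative_symmetric:
  fixes \<phi> :: "'e::euclidean_space \<Rightarrow> 'f::euclidean_space"
  assumes \<phi>: "Ck_on 2 S \<phi>" and "open S" "p \<in> S"
  shows "frechet_derivative (\<lambda>q. frechet_derivative \<phi> (at q) u) (at p) v =
         frechet_derivative (\<lambda>q. frechet_derivative \<phi> (at q) v) (at p) u"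
proof (rule euclidean_eqI)
  fix b :: 'f
  define f where "f q = \<phi> q \<bullet> b" for q
  have f1: "f differentiable (at q)" "frechet_derivative f (at q) w = frechet_derivative \<phi> (at q) w \<bullet> b"
    if "q \<in> S" for q w
    unfolding f_def[abs_def] using frechet_derivative_inner_left[OF Ck_on_2D(1)[OF \<phi> that]] by auto
  have f2: "(\<lambda>r. frechet_derivative f (at r) w) differentiable (at q)"
    "frechet_derivative (\<lambda>r. frechet_derivative f (at r) w) (at q) z =
     frechet_derivative (\<lambda>r. frechet_derivative \<phi> (at r) w) (at q) z \<bullet> b" if "q \<in> S" for q w z
  proof -
    note inner = frechet_derivative_inner_left[OF Ck_on_2D(2)[OF \<phi> that, of w], of b]
    have eq: "frechet_derivative \<phi> (at r) w \<bullet> b = frechet_derivative f (at r) w" if "r \<in> S" for r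
      using f1(2)[OF that] by simp
    show "(\<lambda>r. frechet_derivative f (at r) w) differentiable (at q)"
      using inner(1) has_derivative_transform_within_open[where t = UNIV, OF _ \<open>open S\<close> \<open>q \<in> S\<close> eq]
      unfolding differentiable_def by meson
    show "frechet_derivative (\<lambda>r. frechet_derivative f (at r) w) (at q) z =
     frechet_derivative (\<lambda>r. frechet_derivative \<phi> (at r) w) (at q) z \<bullet> b"
      using frechet_derivative_transform_within_open[OF inner(1) \<open>open S\<close> \<open>q \<in> S\<close> eq] inner(2)
      by metis
  qed
  have "Ck_on 2 S f"
    using f1 f2 Ck_on_2D(3)[OF \<phi>]
    by (auto simp: numeral_2_eq_2 intro!: continuous_intros cong: continuous_on_cong)
  from second_derivative_symmetric_real[OF this assms(2,3)]
  show "frechet_derivative (\<lambda>q. frechet_derivative \<phi> (at q) u) (at p) v \<bullet> b =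
        frechet_derivative (\<lambda>q. frechet_derivative \<phi> (at q) v) (at p) u \<bullet> b"
    by (simp add: f2(2)[OF \<open>p \<in> S\<close>])
qed

text \<open>A convex function lies above its tangents, which makes \<open>f'\<close> increasing.\<close>

lemma convex_on_second_derivative_nonneg:
  fixes f :: "real \<Rightarrow> real"
  assumes "convex_on I f" "open I" "t \<in> I"
    and f': "\<And>s. s \<in> I \<Longrightarrow> (f has_real_derivative f' s) (at s)"
    and d: "(f' has_real_derivative d) (at t)"
  shows "d \<ge> 0"
proof (rule ccontr)
  assume "\<not> d \<ge> 0"
  then obtain e where e: "e > 0" "\<And>h. h > 0 \<Longrightarrow> h < e \<Longrightarrow> f' (t + h) < f' t"
    using DERIV_neg_dec_right[OF d] by auto
  obtain r where r: "r > 0" "\<And>s. \<bar>s - t\<bar> < r \<Longrightarrow> s \<in> I"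
    using assms(2,3) unfolding open_real by blast
  define h where "h = min e r / 2"
  have h: "h > 0" "h < e" "h < r" using e r by (auto simp: h_def)
  have "t + h \<in> I" using r h by simp
  have conn: "connected I"
    using \<open>convex_on I f\<close> by (simp add: convex_connected convex_on_def)
  have tangent: "f y - f x \<ge> f' x * (y - x)" if "x \<in> I" "y \<in> I" for x y
    using convex_on_imp_above_tangent[OF assms(1) conn _ that(2) has_field_derivative_at_within[OF f'[OF that(1)]]]
      that(1) \<open>open I\<close> by (simp add: interior_open)
  from tangent[OF \<open>t \<in> I\<close> \<open>t + h \<in> I\<close>] tangent[OF \<open>t + h \<in> I\<close> \<open>t \<in> I\<close>]
  have "f' t * h \<le> f' (t + h) * h" by simp
  then show False
    using e(2)[OF h(1,2)] h(1) by simp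
qed

section \<open>Metrics on open sets and their geodesics\<close>

locale local_metric =
  fixes S :: "'e::euclidean_space set" and G :: "'e \<Rightarrow> 'e \<Rightarrow> 'e \<Rightarrow> real"
  assumes open_S: "open S"
    and G_linear: "p \<in> S \<Longrightarrow> linear (\<lambda>u. G p u v)"
    and G_sym: "p \<in> S \<Longrightarrow> G p u v = G p v u"
    and G_pos: "p \<in> S \<Longrightarrow> u \<noteq> 0 \<Longrightarrow> G p u u > 0"
    and G_C1: "Ck_on 1 S (\<lambda>p. G p u v)"
begin

lemma G_linear_right: "p \<in> S \<Longrightarrow> linear (G p u)"
  using G_linear[of p u] G_sym[of p u] by (simp add: linear_iff)

lemma G_bilinear: "p \<in> S \<Longrightarrow> bilinear (G p)"
  by (simp add: bilinear_def G_linear G_linear_right)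

lemma G_nonneg: "p \<in> S \<Longrightarrow> G p u u \<ge> 0"
  using G_pos[of p u] bilinear_lzero[OF G_bilinear, of p 0] by (cases "u = 0") auto

lemma G_eqI:
  assumes "p \<in> S" "\<And>z. G p w z = G p w' z"
  shows "w = w'"
proof -
  have "G p (w - w') (w - w') = 0"
    using assms(2) by (simp add: bilinear_lsub[OF G_bilinear[OF assms(1)]])
  then show ?thesis using G_pos[OF assms(1), of "w - w'"] by force
qed

text \<open>Nondegeneracy makes \<open>w \<mapsto> G p w\<close> injective, and hence surjective for reasons of dimension. This
  provides Christoffel vectors and gradients.\<close>

lemma G_represents:
  assumes "p \<in> S" "linear \<omega>"
  shows "\<exists>w. \<forall>z. G p w z = \<omega> z"
proof -
  note bil = G_bilinear[OF assms(1)]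
  (* The vector of coefficients of the functional G p w. *)
  define L where "L w = (\<Sum>b\<in>Basis. G p w b *\<^sub>R b)" for w
  have L_b: "L w \<bullet> b = G p w b" if "b \<in> Basis" for w b
    using that by (simp add: L_def)
  have eq: "G p w z = \<omega> z" if "\<And>b. b \<in> Basis \<Longrightarrow> G p w b = \<omega> b" "linear \<omega>" for w z and \<omega> :: "'e \<Rightarrow> real"
    using linear_eq_stdbasis[OF G_linear_right[OF assms(1)] that(2,1)] by (rule fun_cong)
  have "linear L"
    by (rule linearI; rule euclidean_eqI)
      (simp_all add: L_b bilinear_ladd[OF bil] bilinear_lmul[OF bil] inner_add_left)
  moreover have "inj L"
  proof (rule injI)
    fix w w' assume "L w = L w'"
    then have "G p w b = G p w' b" if "b \<in> Basis" for b using L_b that by metis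
    then have "G p w z = G p w' z" for z
      by (rule eq[OF _ G_linear_right[OF assms(1)]])
    then show "w = w'" by (rule G_eqI[OF assms(1)])
  qed
  ultimately have "surj L" by (rule linear_inj_imp_surj)
  then obtain w where w: "L w = (\<Sum>b\<in>Basis. \<omega> b *\<^sub>R b)" by (metis surjD)
  have "G p w b = \<omega> b" if "b \<in> Basis" for b
    using L_b[OF that, of w] that by (simp add: w)
  then show ?thesis using eq[OF _ assms(2)] by blast
qed

lemma G_Cauchy_Schwarz:
  assumes p: "p \<in> S"
  shows "(G p u v)\<^sup>2 \<le> G p u u * G p v v"
proof (cases "v = 0")
  case True
  then show ?thesis by (simp add: bilinear_rzero[OF G_bilinear[OF p]])
next
  case False
  note bil = G_bilinear[OF p]
  (* A multiple of the component of u that is orthogonal to v. *)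
  define w where "w = G p v v *\<^sub>R u - G p u v *\<^sub>R v"
  have "G p w w = G p v v * (G p u u * G p v v - (G p u v)\<^sup>2)"
    using G_sym[OF p, of v u]
    by (simp add: w_def bilinear_lsub[OF bil] bilinear_rsub[OF bil] bilinear_lmul[OF bil]
        bilinear_rmul[OF bil] algebra_simps power2_eq_square)
  then have "0 \<le> G p v v * (G p u u * G p v v - (G p u v)\<^sup>2)"
    using G_nonneg[OF p, of w] by simp
  then show ?thesis
    using G_pos[OF p False] by (simp add: zero_le_mult_iff)
qed

text \<open>The maximum is attained at the normalised \<open>n\<close>. If \<open>n = 0\<close>, division by zero makes this
  vector \<open>0\<close>, which attains the maximum \<open>0\<close>.\<close>

lemma operator_norm_eq_norm_gradient:
  assumes p: "p \<in> S"
  shows "(SUP z\<in>{z. sqrt (G p z z) \<le> 1}. \<bar>G p n z\<bar>) = sqrt (G p n n)"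
proof (rule cSup_eq_maximum)
  note bil = G_bilinear[OF p]
  define z where "z = (1 / sqrt (G p n n)) *\<^sub>R n"
  have "G p n n = 0 \<longleftrightarrow> n = 0"
    using G_pos[OF p, of n] by (cases "n = 0") (simp_all add: bilinear_lzero[OF bil])
  then have z: "G p z z = (if n = 0 then 0 else 1)" "G p n z = sqrt (G p n n)"
    using G_nonneg[OF p, of n]
    by (auto simp: z_def bilinear_lmul[OF bil] bilinear_rmul[OF bil] bilinear_lzero[OF bil]
        real_div_sqrt simp flip: real_sqrt_mult divide_divide_eq_left)
  have "sqrt (G p n n) = \<bar>G p n z\<bar>" using z(2) G_nonneg[OF p, of n] by simp
  then show "sqrt (G p n n) \<in> (\<lambda>z. \<bar>G p n z\<bar>) ` {z. sqrt (G p z z) \<le> 1}"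
    using z(1) by (intro image_eqI[of _ _ z]) auto
next
  fix s assume "s \<in> (\<lambda>z. \<bar>G p n z\<bar>) ` {z. sqrt (G p z z) \<le> 1}"
  then obtain z where z: "s = \<bar>G p n z\<bar>" "G p z z \<le> 1" by auto
  have "(G p n z)\<^sup>2 \<le> G p n n"
    using order_trans[OF G_Cauchy_Schwarz[OF p] mult_left_mono[OF z(2) G_nonneg[OF p]]] by simp
  then have "sqrt ((G p n z)\<^sup>2) \<le> sqrt (G p n n)" by (rule real_sqrt_le_mono)
  then show "s \<le> sqrt (G p n n)" by (simp add: z(1))
qed

abbreviation DG :: "'e \<Rightarrow> 'e \<Rightarrow> 'e \<Rightarrow> 'e \<Rightarrow> real" where
  "DG p u v \<equiv> frechet_derivative (\<lambda>q. G q u v) (at p)"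

lemma G_has_derivative: "p \<in> S \<Longrightarrow> ((\<lambda>q. G q u v) has_derivative DG p u v) (at p)"
  using G_C1[of u v] by (simp add: frechet_derivative_works)

lemma G_continuous: "continuous_on S (\<lambda>p. G p u v)"
  by (rule has_derivative_continuous_on[OF has_derivative_at_withinI[OF G_has_derivative]])

lemma DG_continuous: "continuous_on S (\<lambda>p. DG p u v z)"
  using G_C1[of u v] by simp

lemma DG_eqI:
  assumes "p \<in> S" "(f has_derivative f') (at p)" "\<And>q. q \<in> S \<Longrightarrow> f q = G q u v"
  shows "DG p u v = f'"
  using has_derivative_transform_within_open[OF assms(2) open_S assms(1,3)]
    frechet_derivative_at by metis

lemma DG_linear: "p \<in> S \<Longrightarrow> linear (DG p u v)"
  using G_has_derivative has_derivative_linear by blast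

lemma DG_linear_middle: "p \<in> S \<Longrightarrow> linear (\<lambda>v. DG p u v z)"
proof (rule linearI)
  assume p: "p \<in> S"
  show "DG p u (v + w) z = DG p u v z + DG p u w z" for v w
    using DG_eqI[OF p has_derivative_add[OF G_has_derivative G_has_derivative, OF p p], of u v u w]
    by (simp add: bilinear_radd[OF G_bilinear])
  show "DG p u (c *\<^sub>R v) z = c *\<^sub>R DG p u v z" for c v
    using DG_eqI[OF p has_derivative_mult_right[OF G_has_derivative, OF p], of c u v u "c *\<^sub>R v"]
    by (simp add: bilinear_rmul[OF G_bilinear])
qed

lemma DG_sym: "p \<in> S \<Longrightarrow> DG p u v = DG p v u"
  by (rule DG_eqI[OF _ G_has_derivative]) (auto simp: G_sym)

lemma DG_linear_left: "p \<in> S \<Longrightarrow> linear (\<lambda>u. DG p u v z)"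
  using DG_linear_middle[of p v z] DG_sym[of p] by simp

text \<open>The right-hand side is linear in \<open>z\<close>, so that the description in the definition of
  \<open>christoffel\<close> is satisfied by exactly one vector.\<close>

lemma christoffel_equation:
  assumes "p \<in> S"
  shows "2 * G p (christoffel G p u v) z = DG p v z u + DG p u z v - DG p u v z"
proof -
  have "linear (\<lambda>z. (DG p v z u + DG p u z v - DG p u v z) / 2)"
    using DG_linear[OF assms, of u v] DG_linear_middle[OF assms, of v u] DG_linear_middle[OF assms, of u v]
    by (simp add: linear_iff algebra_simps add_divide_distrib diff_divide_distrib)
  from G_represents[OF assms this] obtain w
    where "\<And>z. G p w z = (DG p v z u + DG p u z v - DG p u v z) / 2" by blast
  then have w: "2 * G p w z = DG p v z u + DG p u z v - DG p u v z" for z by (simp add: field_simps)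
  have "christoffel G p u v = w"
    unfolding christoffel_def
  proof (rule the_equality)
    show "w' = w" if "\<forall>z. 2 * G p w' z = DG p v z u + DG p u z v - DG p u v z" for w'
    proof (rule G_eqI[OF assms])
      show "G p w' z = G p w z" for z
        using that[rule_format, of z] w[of z] by simp
    qed
  qed (use w in simp)
  then show ?thesis using w by simp
qed

lemma christoffel_eqI:
  assumes "p \<in> S" "\<And>z. 2 * G p w z = 2 * DG p u z u - DG p u u z"
  shows "christoffel G p u u = w"
proof (rule G_eqI[OF assms(1)])
  have cancel: "x = y" if "2 * x = d + d - c" "2 * y = 2 * d - c" for x y c d :: real
    using that by linarith
  show "G p (christoffel G p u u) z = G p w z" for z
    by (rule cancel[OF christoffel_equation[OF assms(1)] assms(2)])
qed

lemma G_has_derivative_along: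
  fixes Y :: "'x::real_normed_vector \<Rightarrow> 'e"
  assumes "Y x \<in> S" "(Y has_derivative Y') (at x)"
    "(\<xi> has_derivative \<xi>') (at x)" "(\<eta> has_derivative \<eta>') (at x)"
  shows "((\<lambda>s. G (Y s) (\<xi> s) (\<eta> s)) has_derivative
    (\<lambda>h. DG (Y x) (\<xi> x) (\<eta> x) (Y' h) + G (Y x) (\<xi>' h) (\<eta> x) + G (Y x) (\<xi> x) (\<eta>' h))) (at x)"
proof -
  have "((\<lambda>qu. G (fst qu) (snd qu) v) has_derivative
      (\<lambda>k. DG (Y x) (\<xi> x) v (fst k) + G (Y x) (snd k) v)) (at (Y x, \<xi> x))" for v
  proof -
    have "((\<lambda>q. G q u v) has_derivative DG (Y x) u v) (at (fst (Y x, \<xi> x)))" for u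
      using G_has_derivative[OF assms(1)] by simp
    from has_derivative_linear_family[where Y = fst and \<eta> = snd and L = "\<lambda>q u. G q u v",
        OF open_S _ G_linear this has_derivative_fst[OF has_derivative_ident] has_derivative_snd[OF has_derivative_ident]]
    show ?thesis using assms(1) by simp
  qed
  from has_derivative_linear_family[where U = "S \<times> UNIV" and L = "\<lambda>qu. G (fst qu) (snd qu)"
      and Y = "\<lambda>s. (Y s, \<xi> s)", simplified, OF open_Times[OF open_S open_UNIV] assms(1) _ this
      has_derivative_Pair[OF assms(2,3)] assms(4)]
  show ?thesis using G_linear_right by (simp add: mem_Times_iff)
qed

text \<open>By compactness of a ball times the unit sphere, the quadratic forms \<open>G q\<close> with \<open>q\<close> near \<open>p\<close> dominate one
  positive multiple of the squared Euclidean norm.\<close>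

lemma coercive_near:
  assumes "p \<in> S"
  obtains r c where "r > 0" "cball p r \<subseteq> S" "c > 0"
    "\<And>q z. q \<in> cball p r \<Longrightarrow> G q z z \<ge> c * (norm z)\<^sup>2"
proof -
  obtain r where r: "r > 0" "cball p r \<subseteq> S"
    using open_S assms open_contains_cball by blast
  let ?C = "cball p r \<times> sphere (0::'e) 1"
  have "continuous_on (S \<times> UNIV) (\<lambda>pz. G (fst pz) (snd pz) (snd pz))"
    by (rule continuous_on_linear_family[where U = "S \<times> UNIV" and L = "\<lambda>pz. G (fst pz) (snd pz)" and Y = "\<lambda>x. x"],
        auto intro!: continuous_intros G_linear_right)
       (rule continuous_on_linear_family[where U = S and Y = fst], auto intro!: continuous_intros G_linear G_continuous)
  then have cont: "continuous_on ?C (\<lambda>pz. G (fst pz) (snd pz) (snd pz))"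
    by (rule continuous_on_subset) (use r in auto)
  obtain b :: 'e where "b \<in> Basis" by (meson nonempty_Basis ex_in_conv)
  then have "(p, b) \<in> ?C" using r by simp
  then have ne: "?C \<noteq> {}" by blast
  have "compact ?C" by (intro compact_Times) auto
  from continuous_attains_inf[OF this ne cont]
  obtain q0 z0 where min: "(q0, z0) \<in> ?C" "\<And>q z. (q, z) \<in> ?C \<Longrightarrow> G q0 z0 z0 \<le> G q z z"
    by fastforce
  show ?thesis
  proof (rule that[OF r])
    show "G q0 z0 z0 > 0" using min(1) r by (intro G_pos) auto
    fix q z assume q: "q \<in> cball p r"
    then have bil: "bilinear (G q)" using r G_bilinear by blast
    show "G q z z \<ge> G q0 z0 z0 * (norm z)\<^sup>2"
    proof (cases "z = 0")
      case False
      define e where "e = z /\<^sub>R norm z"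
      have "(q, e) \<in> ?C" using q False by (simp add: e_def)
      have "z = norm z *\<^sub>R e" using False by (simp add: e_def)
      then have "G q z z = (norm z)\<^sup>2 * G q e e"
        by (metis bilinear_lmul[OF bil] bilinear_rmul[OF bil] mult.assoc power2_eq_square real_scaleR_def)
      then show ?thesis
        using mult_right_mono[OF min(2)[OF \<open>(q, e) \<in> ?C\<close>], of "(norm z)\<^sup>2"] by (simp add: mult.commute)
    qed (simp add: bilinear_lzero[OF bil])
  qed
qed

text \<open>With \<open>w\<^sub>0\<close> the Christoffel vector at the base point and \<open>w\<close> the one at a nearby point, the
  difference \<open>z = w - w\<^sub>0\<close> satisfies \<open>2 G(z, b) = \<epsilon> b\<close> with defects \<open>\<epsilon> b\<close> that depend continuously
  on the point and vanish at the base point. Coercivity turns this into a bound for \<open>z\<close>, which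
  avoids any formula for the inverse matrix of \<open>G\<close>.\<close>

lemma christoffel_continuous:
  "continuous_on (S \<times> UNIV) (\<lambda>pu. christoffel G (fst pu) (snd pu) (snd pu))"
proof (subst continuous_on_eq_continuous_at[OF open_Times[OF open_S open_UNIV]], rule ballI)
  fix pu0 :: "'e \<times> 'e" assume "pu0 \<in> S \<times> UNIV"
  then obtain p0 u0 where pu0: "pu0 = (p0, u0)" "p0 \<in> S" by auto
  define \<Gamma> where "\<Gamma> pu = christoffel G (fst pu) (snd pu) (snd pu)" for pu
  obtain r c where r: "r > 0" "cball p0 r \<subseteq> S" and "c > 0"
    and coercive: "\<And>q z. q \<in> cball p0 r \<Longrightarrow> G q z z \<ge> c * (norm z)\<^sup>2"
    using coercive_near[OF pu0(2)] by blast
  define \<epsilon> where "\<epsilon> z pu = 2 * DG (fst pu) (snd pu) z (snd pu) - DG (fst pu) (snd pu) (snd pu) z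
      - 2 * G (fst pu) (\<Gamma> pu0) z" for z :: 'e and pu :: "'e \<times> 'e"
  have \<epsilon>_eq: "\<epsilon> z pu = 2 * G (fst pu) (\<Gamma> pu - \<Gamma> pu0) z" if "fst pu \<in> S" for z pu
    using christoffel_equation[OF that, of "snd pu" "snd pu" z]
    by (simp add: \<epsilon>_def \<Gamma>_def bilinear_lsub[OF G_bilinear[OF that]])
  have cont1: "continuous_on (S \<times> UNIV) (\<lambda>pu. DG (fst pu) (snd pu) z v)" for z v
    by (rule continuous_on_linear_family[where U = S and Y = fst], auto intro!: continuous_intros DG_linear_left DG_continuous)
  have cont2: "continuous_on (S \<times> UNIV) (\<lambda>pu. DG (fst pu) (snd pu) z (snd pu))" for z
    by (rule continuous_on_linear_family[where U = "S \<times> UNIV" and L = "\<lambda>pu. DG (fst pu) (snd pu) z" and Y = "\<lambda>x. x"])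
      (auto intro!: continuous_intros DG_linear cont1)
  have cont3: "continuous_on (S \<times> UNIV) (\<lambda>pu. DG (fst pu) (snd pu) (snd pu) z)" for z
    by (rule continuous_on_linear_family[where U = "S \<times> UNIV" and L = "\<lambda>pu v. DG (fst pu) (snd pu) v z" and Y = "\<lambda>x. x"])
      (auto intro!: continuous_intros DG_linear_middle cont1)
  have "continuous_on (S \<times> UNIV) (\<epsilon> z)" for z
    unfolding \<epsilon>_def[abs_def]
    by (intro continuous_intros cont2 cont3 continuous_on_compose2[OF G_continuous]) auto
  then have "isCont (\<epsilon> z) pu0" for z
    using pu0 open_S by (metis UNIV_I continuous_on_eq_continuous_at mem_Times_iff fst_conv open_Times open_UNIV)
  then have "isCont (\<lambda>pu. (\<Sum>b\<in>Basis. \<bar>\<epsilon> b pu\<bar>) / (2 * c)) pu0"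
    using \<open>c > 0\<close> by (intro continuous_intros) auto
  then have lim: "((\<lambda>pu. (\<Sum>b\<in>Basis. \<bar>\<epsilon> b pu\<bar>) / (2 * c)) \<longlongrightarrow> 0) (at pu0)"
    using \<epsilon>_eq[of pu0] pu0 by (simp add: isCont_def bilinear_lzero[OF G_bilinear])
  have bound: "norm (\<Gamma> pu - \<Gamma> pu0) \<le> (\<Sum>b\<in>Basis. \<bar>\<epsilon> b pu\<bar>) / (2 * c)" if p: "fst pu \<in> cball p0 r" for pu
  proof (cases "\<Gamma> pu = \<Gamma> pu0")
    case False
    define z where "z = \<Gamma> pu - \<Gamma> pu0"
    have pS: "fst pu \<in> S" using p r by blast
    have "2 * (c * (norm z)\<^sup>2) \<le> 2 * G (fst pu) z z" using coercive[OF p] by simp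
    also have "\<dots> = (\<Sum>b\<in>Basis. (z \<bullet> b) * (2 * G (fst pu) z b))"
      by (subst linear_Basis_expansion[OF G_linear_right[OF pS]]) (simp add: sum_distrib_left mult_ac)
    also have "\<dots> = (\<Sum>b\<in>Basis. (z \<bullet> b) * \<epsilon> b pu)"
      by (simp add: \<epsilon>_eq[OF pS] z_def)
    also have "\<dots> \<le> (\<Sum>b\<in>Basis. norm z * \<bar>\<epsilon> b pu\<bar>)"
    proof (rule sum_mono)
      fix b :: 'e assume "b \<in> Basis"
      have "(z \<bullet> b) * \<epsilon> b pu \<le> \<bar>z \<bullet> b\<bar> * \<bar>\<epsilon> b pu\<bar>" by (simp flip: abs_mult)
      also have "\<dots> \<le> norm z * \<bar>\<epsilon> b pu\<bar>"
        using Basis_le_norm[OF \<open>b \<in> Basis\<close>] by (intro mult_right_mono) auto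
      finally show "(z \<bullet> b) * \<epsilon> b pu \<le> norm z * \<bar>\<epsilon> b pu\<bar>" .
    qed
    also have "\<dots> = norm z * (\<Sum>b\<in>Basis. \<bar>\<epsilon> b pu\<bar>)" by (simp add: sum_distrib_left)
    finally have "norm z * (2 * c * norm z) \<le> norm z * (\<Sum>b\<in>Basis. \<bar>\<epsilon> b pu\<bar>)"
      by (simp add: power2_eq_square mult_ac)
    then have "2 * c * norm z \<le> (\<Sum>b\<in>Basis. \<bar>\<epsilon> b pu\<bar>)"
      using False by (simp add: z_def)
    then show ?thesis
      using \<open>c > 0\<close> by (simp add: z_def field_simps)
  qed (use \<open>c > 0\<close> in \<open>simp add: sum_nonneg\<close>)
  have "\<forall>\<^sub>F pu in at pu0. fst pu \<in> ball p0 r"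
    by (rule topological_tendstoD[OF tendsto_fst[OF tendsto_ident_at]]) (use pu0 r(1) in auto)
  then have "\<forall>\<^sub>F pu in at pu0. norm (\<Gamma> pu - \<Gamma> pu0) \<le> (\<Sum>b\<in>Basis. \<bar>\<epsilon> b pu\<bar>) / (2 * c)"
    by eventually_elim (rule bound, use ball_subset_cball in blast)
  from Lim_null_comparison[OF this lim] have "((\<lambda>pu. \<Gamma> pu - \<Gamma> pu0) \<longlongrightarrow> 0) (at pu0)" .
  then show "isCont (\<lambda>pu. christoffel G (fst pu) (snd pu) (snd pu)) pu0"
    unfolding isCont_def \<Gamma>_def by (simp add: LIM_zero_iff)
qed

text \<open>The geodesic equation as a first-order system for the pair \<open>(y, y')\<close>.\<close>

lemma local_geodesic_exists:
  assumes "p \<in> S"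
  obtains T y y' where "T > 0" "y 0 = p" "y' 0 = u"
    "\<And>t. t \<in> {-T<..<T} \<Longrightarrow> y t \<in> S"
    "\<And>t. t \<in> {-T<..<T} \<Longrightarrow> (y has_vector_derivative y' t) (at t)"
    "\<And>t. t \<in> {-T<..<T} \<Longrightarrow>
       (y' has_vector_derivative - christoffel G (y t) (y' t) (y' t)) (at t)"
proof -
  define K where "K pu = (snd pu, - christoffel G (fst pu) (snd pu) (snd pu))" for pu
  have "continuous_on (S \<times> UNIV) K"
    unfolding K_def[abs_def] by (intro continuous_intros christoffel_continuous)
  then obtain T z where T: "T > 0" "z 0 = (p, u)"
    "\<And>t. t \<in> {-T<..<T} \<Longrightarrow> z t \<in> S \<times> UNIV"
    and z: "\<And>t. t \<in> {-T<..<T} \<Longrightarrow> (z has_vector_derivative K (z t)) (at t)"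
    using Peano_existence[of "S \<times> UNIV" "(p, u)" K] assms open_Times[OF open_S open_UNIV] by auto
  show ?thesis
  proof (rule that[of T "\<lambda>t. fst (z t)" "\<lambda>t. snd (z t)"])
    fix t assume t: "t \<in> {-T<..<T}"
    show "((\<lambda>t. fst (z t)) has_vector_derivative snd (z t)) (at t)"
      using bounded_linear.has_vector_derivative[OF bounded_linear_fst z[OF t]] by (simp add: K_def)
    show "((\<lambda>t. snd (z t)) has_vector_derivative
        - christoffel G (fst (z t)) (snd (z t)) (snd (z t))) (at t)"
      using bounded_linear.has_vector_derivative[OF bounded_linear_snd z[OF t]] by (simp add: K_def)
    show "fst (z t) \<in> S" using T(3)[OF t] by (simp add: mem_Times_iff)
  qed (use T in auto)
qed

end

section \<open>Geodesics under a change of coordinates\<close>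

locale metric_isometry =
  source: local_metric S G + target: local_metric S' G'
  for S :: "'e::euclidean_space set" and G and S' :: "'e set" and G' +
  fixes U :: "'e set" and \<phi> :: "'e \<Rightarrow> 'e"
  assumes open_U: "open U" and U_subset: "U \<subseteq> S" and maps: "q \<in> U \<Longrightarrow> \<phi> q \<in> S'"
    and \<phi>_C2: "Ck_on 2 U \<phi>"
    and isometric: "q \<in> U \<Longrightarrow>
      G q u v = G' (\<phi> q) (frechet_derivative \<phi> (at q) u) (frechet_derivative \<phi> (at q) v)"
begin

text \<open>Differentiating \<open>G(v, w) = G'(D\<phi> v, D\<phi> w)\<close> expresses the derivatives of \<open>G\<close> through those of
  \<open>G'\<close> and \<open>D\<^sup>2\<phi>\<close>. In the combination that defines \<open>2 G(\<Gamma>(u, u), z)\<close> the two terms with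
  \<open>D\<^sup>2\<phi>(u, z)\<close> and \<open>D\<^sup>2\<phi>(z, u)\<close> cancel by symmetry, and \<open>2 G'(D\<^sup>2\<phi>(u, u), D\<phi> z)\<close> is left over.\<close>

lemma christoffel_transform:
  assumes p: "p \<in> U"
  defines "D \<equiv> frechet_derivative \<phi> (at p)"
  shows "D (christoffel G p u u) = christoffel G' (\<phi> p) (D u) (D u)
    + frechet_derivative (\<lambda>q. frechet_derivative \<phi> (at q) u) (at p) u"
proof -
  define D2 where "D2 v = frechet_derivative (\<lambda>q. frechet_derivative \<phi> (at q) v) (at p)" for v
  have pS: "p \<in> S" and pS': "\<phi> p \<in> S'" using p U_subset maps by auto
  have d\<phi>: "(\<phi> has_derivative D) (at p)"
    using Ck_on_2D(1)[OF \<phi>_C2 p] by (simp add: frechet_derivative_works D_def)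
  have d2\<phi>: "((\<lambda>q. frechet_derivative \<phi> (at q) v) has_derivative D2 v) (at p)" for v
    using Ck_on_2D(2)[OF \<phi>_C2 p] by (simp add: frechet_derivative_works D2_def)
  have sym: "D2 v w = D2 w v" for v w
    unfolding D2_def by (rule second_derivative_symmetric[OF \<phi>_C2 open_U p])
  note linD = has_derivative_linear[OF d\<phi>]
  have "inj D"
  proof (subst linear_injective_0[OF linD], intro allI impI)
    fix v assume "D v = 0"
    then have "G p v v = 0"
      using isometric[OF p, of v v] target.G_bilinear[OF pS'] by (simp add: D_def bilinear_lzero)
    then show "v = 0" using source.G_pos[OF pS, of v] by force
  qed
  then have "surj D" by (rule linear_inj_imp_surj[OF linD])
  have pull: "source.DG p v w z = target.DG (\<phi> p) (D v) (D w) (D z)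
      + G' (\<phi> p) (D2 v z) (D w) + G' (\<phi> p) (D v) (D2 w z)" for v w z
  proof -
    have "((\<lambda>q. G q v w) has_derivative (\<lambda>z. target.DG (\<phi> p) (D v) (D w) (D z)
      + G' (\<phi> p) (D2 v z) (D w) + G' (\<phi> p) (D v) (D2 w z))) (at p)"
      using has_derivative_transform_within_open[OF
          target.G_has_derivative_along[OF pS' d\<phi> d2\<phi>[of v] d2\<phi>[of w]]
          open_U p isometric[symmetric]]
      unfolding D_def .
    from frechet_derivative_at[OF this, symmetric] show ?thesis by simp
  qed
  note bil = target.G_bilinear[OF pS']
  have "christoffel G' (\<phi> p) (D u) (D u) = D (christoffel G p u u) - D2 u u"
  proof (rule target.christoffel_eqI[OF pS'])
    fix z' :: 'e
    obtain z where z: "z' = D z" using \<open>surj D\<close> by (metis surjD)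
    have "2 * G' (\<phi> p) (D (christoffel G p u u)) (D z) = 2 * source.DG p u z u - source.DG p u u z"
      using source.christoffel_equation[OF pS, of u u z] isometric[OF p] by (simp add: D_def)
    also have "\<dots> = 2 * target.DG (\<phi> p) (D u) (D z) (D u) - target.DG (\<phi> p) (D u) (D u) (D z)
        + 2 * G' (\<phi> p) (D2 u u) (D z)"
      using target.G_sym[OF pS', of "D u" "D2 u z"] by (simp add: pull sym[of z u])
    finally show "2 * G' (\<phi> p) (D (christoffel G p u u) - D2 u u) z' =
        2 * target.DG (\<phi> p) (D u) z' (D u) - target.DG (\<phi> p) (D u) (D u) z'"
      by (simp add: z bilinear_lsub[OF bil])
  qed
  then show ?thesis by (simp add: D2_def)
qed

text \<open>The term \<open>D\<^sup>2\<phi>(y', y')\<close> in the acceleration of \<open>\<phi> \<circ> y\<close> is the one by which the Christoffel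
  vectors fail to be tensorial, so the two compensate.\<close>

lemma geodesic_transform:
  assumes p: "y t \<in> U" and y: "(y has_vector_derivative y' t) (at t)"
    and y': "(y' has_vector_derivative - christoffel G (y t) (y' t) (y' t)) (at t)"
  shows "((\<lambda>s. \<phi> (y s)) has_vector_derivative frechet_derivative \<phi> (at (y t)) (y' t)) (at t)"
    and "((\<lambda>s. frechet_derivative \<phi> (at (y s)) (y' s)) has_vector_derivative
      - christoffel G' (\<phi> (y t)) (frechet_derivative \<phi> (at (y t)) (y' t))
          (frechet_derivative \<phi> (at (y t)) (y' t))) (at t)"
proof -
  have "linear (frechet_derivative \<phi> (at (y t)))"
    using Ck_on_2D(1)[OF \<phi>_C2 p] by (simp add: linear_frechet_derivative)
  note neg = linear_neg[OF this]
  note along = has_vector_derivative_differential_along[OF \<phi>_C2 open_U p y y' refl]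
  show "((\<lambda>s. \<phi> (y s)) has_vector_derivative frechet_derivative \<phi> (at (y t)) (y' t)) (at t)"
    by (rule along)
  show "((\<lambda>s. frechet_derivative \<phi> (at (y s)) (y' s)) has_vector_derivative
      - christoffel G' (\<phi> (y t)) (frechet_derivative \<phi> (at (y t)) (y' t))
          (frechet_derivative \<phi> (at (y t)) (y' t))) (at t)"
    using along(2) by (simp add: neg christoffel_transform[OF p])
qed

end

section \<open>Conformal change of the metric\<close>

locale conformal_change = local_metric S G for S :: "'e::euclidean_space set" and G +
  fixes a :: "'e \<Rightarrow> real"
  assumes a_C2: "Ck_on 2 S a" and a_pos: "p \<in> S \<Longrightarrow> a p > 0"
begin

lemma a_has_derivative: "p \<in> S \<Longrightarrow> (a has_derivative frechet_derivative a (at p)) (at p)"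
  using Ck_on_2D(1)[OF a_C2] by (simp add: frechet_derivative_works)

lemma conformal_has_derivative:
  assumes "p \<in> S"
  shows "((\<lambda>q. a q * G q u v) has_derivative
    (\<lambda>z. a p * DG p u v z + frechet_derivative a (at p) z * G p u v)) (at p)"
  by (rule has_derivative_mult[OF a_has_derivative[OF assms] G_has_derivative[OF assms]])

lemma conformal_local_metric: "local_metric S (\<lambda>p u v. a p * G p u v)"
proof (rule local_metric.intro)
  fix p u v assume p: "p \<in> S"
  show "linear (\<lambda>u. a p * G p u v)"
    using G_linear[OF p, of v] by (simp add: linear_iff algebra_simps)
  show "a p * G p u v = a p * G p v u" using G_sym[OF p] by metis
  show "a p * G p u u > 0" if "u \<noteq> 0" using G_pos[OF p that] a_pos[OF p] by simp
next
  fix u v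
  have conta: "continuous_on S a"
    by (rule has_derivative_continuous_on[OF has_derivative_at_withinI[OF a_has_derivative]])
  have contDa: "continuous_on S (\<lambda>p. frechet_derivative a (at p) z)" for z
    using Ck_on_2D(2)[OF a_C2, of _ z]
    by (intro continuous_at_imp_continuous_on ballI differentiable_imp_continuous_within) auto
  have "continuous_on S (\<lambda>p. a p * DG p u v z + frechet_derivative a (at p) z * G p u v)" for z
    by (intro continuous_intros G_continuous conta contDa DG_continuous)
  moreover have "a p * DG p u v z + frechet_derivative a (at p) z * G p u v =
      frechet_derivative (\<lambda>q. a q * G q u v) (at p) z" if "p \<in> S" for p z
    by (rule fun_cong[OF frechet_derivative_at[OF conformal_has_derivative[OF that]]])
  ultimately have "continuous_on S (\<lambda>p. frechet_derivative (\<lambda>q. a q * G q u v) (at p) z)" for z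
    by (rule continuous_on_eq)
  moreover have "(\<lambda>q. a q * G q u v) differentiable (at p)" if "p \<in> S" for p
    using conformal_has_derivative[OF that] by (rule differentiableI)
  ultimately show "Ck_on 1 S (\<lambda>p. a p * G p u v)" by simp
qed (rule open_S)

text \<open>The product rule gives \<open>2 a G(\<Gamma>\<^sub>a(u, u), z) = 2 a G(\<Gamma>(u, u), z) + 2 (Da u) G(u, z) - (Da z) G(u, u)\<close>
  for the Christoffel vector \<open>\<Gamma>\<^sub>a(u, u)\<close> of \<open>a G\<close>. The gradient \<open>n\<close> of \<open>a\<close> enters through \<open>Da z = G(n, z)\<close>.\<close>

lemma conformal_christoffel:
  assumes p: "p \<in> S" and n: "\<And>z. G p n z = frechet_derivative a (at p) z"
  shows "christoffel (\<lambda>p u v. a p * G p u v) p u u =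
    christoffel G p u u + (frechet_derivative a (at p) u / a p) *\<^sub>R u - (G p u u / (2 * a p)) *\<^sub>R n"
proof -
  interpret conf: local_metric S "\<lambda>p u v. a p * G p u v" by (rule conformal_local_metric)
  note bil = G_bilinear[OF p]
  have DH: "conf.DG p u v z = a p * DG p u v z + frechet_derivative a (at p) z * G p u v" for v z
    using fun_cong[OF frechet_derivative_at[OF conformal_has_derivative[OF p]], symmetric] .
  show ?thesis
  proof (rule conf.christoffel_eqI[OF p])
    fix z
    have eq: "2 * G p (christoffel G p u u) z = 2 * DG p u z u - DG p u u z"
      using christoffel_equation[OF p, of u u z] by simp
    have "2 * (a p * G p (christoffel G p u u + (frechet_derivative a (at p) u / a p) *\<^sub>R u
        - (G p u u / (2 * a p)) *\<^sub>R n) z) = a p * (2 * G p (christoffel G p u u) z)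
        + 2 * frechet_derivative a (at p) u * G p u z - G p u u * frechet_derivative a (at p) z"
      using a_pos[OF p]
      by (simp add: bilinear_lsub[OF bil] bilinear_ladd[OF bil] bilinear_lmul[OF bil] n
          ring_distribs)
    also have "\<dots> = 2 * conf.DG p u z u - conf.DG p u u z"
      unfolding eq DH by (simp add: ring_distribs)
    finally show "2 * (a p * G p (christoffel G p u u + (frechet_derivative a (at p) u / a p) *\<^sub>R u
        - (G p u u / (2 * a p)) *\<^sub>R n) z) = 2 * conf.DG p u z u - conf.DG p u u z" .
  qed
qed

text \<open>The quotient rule for \<open>Da(y)(y') / a(y)\<close>, with the acceleration eliminated by the geodesic
  equation. One half of the coefficient \<open>4\<close> comes from the term \<open>(Da u / a) u\<close> in the Christoffel vector of
  \<open>a G\<close>, the other half from the derivative of the denominator.\<close>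

lemma ln_second_derivative_along_geodesic:
  assumes p: "y t \<in> S" and n: "\<And>z. G (y t) n z = frechet_derivative a (at (y t)) z"
    and y: "(y has_vector_derivative y' t) (at t)"
    and y': "(y' has_vector_derivative
      - christoffel (\<lambda>p u v. a p * G p u v) (y t) (y' t) (y' t)) (at t)"
  defines "Da \<equiv> frechet_derivative a (at (y t))"
  defines "Hess \<equiv> frechet_derivative (\<lambda>q. frechet_derivative a (at q) (y' t)) (at (y t)) (y' t)
      - Da (christoffel G (y t) (y' t) (y' t))"
  shows "((\<lambda>s. ln (a (y s))) has_real_derivative Da (y' t) / a (y t)) (at t)"
    and "((\<lambda>s. frechet_derivative a (at (y s)) (y' s) / a (y s)) has_real_derivative
      (2 * a (y t) * Hess + G (y t) n n * G (y t) (y' t) (y' t) - 4 * (Da (y' t))\<^sup>2)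
      / (2 * (a (y t))\<^sup>2)) (at t)"
proof -
  note pos = a_pos[OF p]
  have lin: "linear Da"
    unfolding Da_def using has_derivative_linear[OF a_has_derivative[OF p]] .
  note along = has_vector_derivative_differential_along[OF a_C2 open_S p y y' refl,
      folded has_real_derivative_iff_has_vector_derivative Da_def]
  show "((\<lambda>s. ln (a (y s))) has_real_derivative Da (y' t) / a (y t)) (at t)"
    using DERIV_chain2[OF DERIV_ln_divide[OF pos] along(1)] by simp
  have "Da (- christoffel (\<lambda>p u v. a p * G p u v) (y t) (y' t) (y' t)) =
    - Da (christoffel G (y t) (y' t) (y' t)) - (Da (y' t))\<^sup>2 / a (y t)
    + G (y t) (y' t) (y' t) * G (y t) n n / (2 * a (y t))"
    by (simp add: conformal_christoffel[OF p n] linear_neg[OF lin] linear_add[OF lin] linear_diff[OF lin]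
        linear_cmul[OF lin] power2_eq_square n flip: Da_def)
  note second = along(2)[unfolded this]
  have "((\<lambda>s. frechet_derivative a (at (y s)) (y' s)) has_real_derivative
     Hess - (Da (y' t))\<^sup>2 / a (y t) + G (y t) (y' t) (y' t) * G (y t) n n / (2 * a (y t))) (at t)"
    using second by (simp add: Hess_def algebra_simps)
  from DERIV_divide[OF this along(1)] have "((\<lambda>s. frechet_derivative a (at (y s)) (y' s) / a (y s))
      has_real_derivative ((Hess - (Da (y' t))\<^sup>2 / a (y t)
        + G (y t) (y' t) (y' t) * G (y t) n n / (2 * a (y t))) * a (y t) - Da (y' t) * Da (y' t))
      / (a (y t) * a (y t))) (at t)"
    using pos by (simp add: Da_def)
  then show "((\<lambda>s. frechet_derivative a (at (y s)) (y' s) / a (y s)) has_real_derivative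
      (2 * a (y t) * Hess + G (y t) n n * G (y t) (y' t) (y' t) - 4 * (Da (y' t))\<^sup>2)
      / (2 * (a (y t))\<^sup>2)) (at t)"
    by (rule DERIV_cong) (use pos in \<open>simp add: field_simps power2_eq_square\<close>)
qed

end

section \<open>Charts and tangent vectors\<close>

lemma continuous_map_open_preimage:
  assumes "continuous_map (top_of_set I) X \<gamma>" "open I" "openin X V"
  shows "open {s \<in> I. \<gamma> s \<in> V}"
proof -
  have "openin (top_of_set I) {s \<in> topspace (top_of_set I). \<gamma> s \<in> V}"
    by (rule openin_continuous_map_preimage[OF assms(1,3)])
  then show ?thesis using openin_open_trans[OF _ \<open>open I\<close>] by simp
qed

locale smooth_atlas =
  fixes X :: "'a topology" and A :: "('a, 'e::euclidean_space) chart set"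
  assumes smooth: "smooth_manifold X A"
begin

abbreviation overlap where "overlap c d \<equiv> cmap c ` (cdom c \<inter> cdom d)"
abbreviation transition where "transition c d \<equiv> cmap d \<circ> cinv c"

lemma chart:
  assumes "c \<in> A"
  shows chart_domain_open: "openin X (cdom c)"
    and chart_range_open: "open (cran c)"
    and chart_homeomorphic: "homeomorphic_map (subtopology X (cdom c)) (top_of_set (cran c)) (cmap c)"
  using smooth assms unfolding smooth_manifold_def by auto

lemma topspace_chart: "c \<in> A \<Longrightarrow> topspace (subtopology X (cdom c)) = cdom c"
  using openin_subset[OF chart_domain_open, of c] by (simp add: Int_absorb1)

lemma cmap_inj: "c \<in> A \<Longrightarrow> inj_on (cmap c) (cdom c)"
  using homeomorphic_imp_injective_map[OF chart_homeomorphic] topspace_chart by metis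

lemma cinv_cmap: "c \<in> A \<Longrightarrow> x \<in> cdom c \<Longrightarrow> cinv c (cmap c x) = x"
  by (rule inv_into_f_f[OF cmap_inj])

lemma cinv_in_cdom: "p \<in> cran c \<Longrightarrow> cinv c p \<in> cdom c"
  by (rule inv_into_into)

lemma cmap_cinv: "p \<in> cran c \<Longrightarrow> cmap c (cinv c p) = p"
  by (rule f_inv_into_f)

lemma cinv_continuous:
  assumes "c \<in> A"
  shows "continuous_map (top_of_set (cran c)) X (cinv c)"
proof -
  obtain f where f: "homeomorphic_maps (subtopology X (cdom c)) (top_of_set (cran c)) (cmap c) f"
    using chart_homeomorphic[OF assms] homeomorphic_map_maps by blast
  then have "continuous_map (top_of_set (cran c)) X f"
    by (auto simp: homeomorphic_maps_def continuous_map_in_subtopology)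
  moreover have "f p = cinv c p" if "p \<in> topspace (top_of_set (cran c))" for p
  proof -
    have "p \<in> cran c" using that by simp
    then obtain x where x: "p = cmap c x" "x \<in> cdom c" by (rule imageE)
    have "f (cmap c x) = x"
      using f x(2) by (simp only: homeomorphic_maps_def topspace_chart[OF assms])
    then show ?thesis using x cinv_cmap[OF assms] by simp
  qed
  ultimately show ?thesis by (rule continuous_map_eq)
qed

lemma open_image_chart:
  assumes "c \<in> A" "openin X V"
  shows "open (cmap c ` (cdom c \<inter> V))"
proof -
  have "openin (subtopology X (cdom c)) (cdom c \<inter> V)"
    using assms(2) by (auto simp: openin_subtopology)
  then have "openin (top_of_set (cran c)) (cmap c ` (cdom c \<inter> V))"
    using homeomorphic_imp_open_map[OF chart_homeomorphic[OF assms(1)]] by (simp add: open_map_def)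
  then show ?thesis
    using openin_open_trans chart_range_open[OF assms(1)] by blast
qed

lemma overlap_open: "c \<in> A \<Longrightarrow> d \<in> A \<Longrightarrow> open (overlap c d)"
  by (rule open_image_chart[OF _ chart_domain_open])

lemma transition_smooth: "c \<in> A \<Longrightarrow> d \<in> A \<Longrightarrow> Ck_on k (overlap c d) (transition c d)"
  using smooth unfolding smooth_manifold_def smooth_on_def by blast

lemma transition_has_derivative:
  assumes "c \<in> A" "d \<in> A" "x \<in> cdom c" "x \<in> cdom d"
  shows "(transition c d has_derivative frechet_derivative (transition c d) (at (cmap c x))) (at (cmap c x))"
  using Ck_on_2D(1)[OF transition_smooth[OF assms(1,2)], of "cmap c x"] assms(3,4)
  by (simp add: frechet_derivative_works)

text \<open>The chain rule for \<open>e \<circ> c\<^sup>-\<^sup>1 = (e \<circ> d\<^sup>-\<^sup>1) \<circ> (d \<circ> c\<^sup>-\<^sup>1)\<close>. It makes the families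
  \<open>coord_vec A c x u\<close> tangent vectors and relates those coming from different charts.\<close>

lemma transition_derivative_cocycle:
  assumes "c \<in> A" "d \<in> A" "e \<in> A" "x \<in> cdom c" "x \<in> cdom d" "x \<in> cdom e"
  shows "frechet_derivative (transition c e) (at (cmap c x)) u =
    frechet_derivative (transition d e) (at (cmap d x)) (frechet_derivative (transition c d) (at (cmap c x)) u)"
proof -
  let ?W = "cmap c ` (cdom c \<inter> (cdom d \<inter> cdom e))"
  have W: "open ?W" "cmap c x \<in> ?W"
    using assms by (auto intro!: open_image_chart openin_Int chart_domain_open)
  have "((\<lambda>p. transition d e (transition c d p)) has_derivative
     (\<lambda>u. frechet_derivative (transition d e) (at (cmap d x))
       (frechet_derivative (transition c d) (at (cmap c x)) u))) (at (cmap c x))"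
    using has_derivative_compose[OF transition_has_derivative[OF assms(1,2,4,5)], of "transition d e"]
      transition_has_derivative[OF assms(2,3,5,6)] assms by (simp add: cinv_cmap)
  then have "(transition c e has_derivative
     (\<lambda>u. frechet_derivative (transition d e) (at (cmap d x))
       (frechet_derivative (transition c d) (at (cmap c x)) u))) (at (cmap c x))"
    by (rule has_derivative_transform_within_open[OF _ W]) (auto simp: cinv_cmap assms)
  from fun_cong[OF frechet_derivative_at[OF this]] show ?thesis by simp
qed

lemma transition_derivative_self:
  assumes "c \<in> A" "x \<in> cdom c"
  shows "frechet_derivative (transition c c) (at (cmap c x)) u = u"
proof -
  have "(transition c c has_derivative (\<lambda>u. u)) (at (cmap c x))"
    by (rule has_derivative_transform_within_open[OF has_derivative_ident chart_range_open[OF assms(1)]])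
      (use assms in \<open>auto simp: cmap_cinv\<close>)
  from fun_cong[OF frechet_derivative_at[OF this]] show ?thesis by simp
qed

lemma coord_vec_chart: "c \<in> charts_at A x \<Longrightarrow> coord_vec A c x u c = u"
  by (simp add: coord_vec_def charts_at_def transition_derivative_self)

lemma coord_vec_in_tangent_space:
  assumes "c \<in> charts_at A x"
  shows "coord_vec A c x u \<in> tangent_space A x"
proof -
  have "frechet_derivative (transition c e) (at (cmap c x)) u =
      frechet_derivative (transition d e) (at (cmap d x)) (frechet_derivative (transition c d) (at (cmap c x)) u)"
    if "d \<in> charts_at A x" "e \<in> charts_at A x" for d e
    using assms that unfolding charts_at_def by (intro transition_derivative_cocycle) auto
  from this[symmetric] show ?thesis
    unfolding tangent_space_def coord_vec_def by simp
qed

lemma coord_vec_tangent: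
  assumes "c \<in> charts_at A x" "v \<in> tangent_space A x"
  shows "coord_vec A c x (v c) = v"
proof
  fix d
  have "v d = frechet_derivative (transition c d) (at (cmap c x)) (v c)" if "d \<in> charts_at A x"
    using assms that unfolding tangent_space_def by blast
  moreover have "v d = 0" if "d \<notin> charts_at A x"
    using assms that unfolding tangent_space_def by blast
  ultimately show "coord_vec A c x (v c) d = v d"
    unfolding coord_vec_def by presburger
qed

lemma coord_vec_transition:
  assumes "c \<in> charts_at A x" "d \<in> charts_at A x"
  shows "coord_vec A d x (frechet_derivative (transition c d) (at (cmap c x)) u) = coord_vec A c x u"
proof -
  have "frechet_derivative (transition c e) (at (cmap c x)) u =
      frechet_derivative (transition d e) (at (cmap d x)) (frechet_derivative (transition c d) (at (cmap c x)) u)"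
    if "e \<in> charts_at A x" for e
    using assms that unfolding charts_at_def by (intro transition_derivative_cocycle) auto
  from this[symmetric] show ?thesis
    unfolding coord_vec_def by (intro ext) simp
qed

lemma coord_vec_linear:
  assumes "c \<in> charts_at A x"
  shows "coord_vec A c x (a *\<^sub>R u + b *\<^sub>R v) = (\<lambda>d. a *\<^sub>R coord_vec A c x u d + b *\<^sub>R coord_vec A c x v d)"
proof
  fix d
  show "coord_vec A c x (a *\<^sub>R u + b *\<^sub>R v) d = a *\<^sub>R coord_vec A c x u d + b *\<^sub>R coord_vec A c x v d"
  proof (cases "d \<in> charts_at A x")
    case True
    then have "linear (frechet_derivative (transition c d) (at (cmap c x)))"
      using assms unfolding charts_at_def
      by (intro has_derivative_linear[OF transition_has_derivative]) simp_all
    from linear_add[OF this] linear_cmul[OF this] show ?thesis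
      using True by (simp add: coord_vec_def)
  qed (simp add: coord_vec_def)
qed

lemma charts_at_cinv: "c \<in> A \<Longrightarrow> p \<in> cran c \<Longrightarrow> c \<in> charts_at A (cinv c p)"
  by (simp add: charts_at_def inv_into_into)

lemma chart_at_in_charts_at:
  assumes "x \<in> topspace X"
  shows "chart_at A x \<in> charts_at A x"
proof -
  obtain c where "c \<in> A" "x \<in> cdom c"
    using smooth assms unfolding smooth_manifold_def by blast
  then show ?thesis
    unfolding chart_at_def by (intro someI[of "\<lambda>c. c \<in> charts_at A x" c]) (simp add: charts_at_def)
qed

text \<open>Coordinate vectors in two charts that correspond under the derivative of the transition map
  represent one tangent vector, so that chart changes are isometries.\<close>

lemma coord_metric_transition:
  assumes "c \<in> A" "d \<in> A" "q \<in> overlap c d"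
  shows "coord_metric A h c q u v = coord_metric A h d (transition c d q)
    (frechet_derivative (transition c d) (at q) u) (frechet_derivative (transition c d) (at q) v)"
proof -
  obtain x where x: "x \<in> cdom c" "x \<in> cdom d" "q = cmap c x" using assms(3) by auto
  then have "c \<in> charts_at A x" "d \<in> charts_at A x" using assms by (auto simp: charts_at_def)
  from coord_vec_transition[OF this] show ?thesis
    using x assms by (simp add: coord_metric_def cinv_cmap)
qed

end

locale riemannian_atlas =
  fixes X :: "'a topology" and A :: "('a, 'e::euclidean_space) chart set" and g :: "('a, 'e) metric"
  assumes riemannian: "riemannian_manifold X A g"

sublocale riemannian_atlas \<subseteq> smooth_atlas X A
  using riemannian by unfold_locales (simp add: riemannian_manifold_def)

context riemannian_atlas
begin

lemma coord_metric_local_metric: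
  assumes c: "c \<in> A"
  shows "local_metric (cran c) (coord_metric A g c)"
proof (rule local_metric.intro)
  show "open (cran c)" by (rule chart_range_open[OF c])
  show "Ck_on 1 (cran c) (\<lambda>p. coord_metric A g c p u v)" for u v
    using riemannian c unfolding riemannian_manifold_def smooth_on_def by blast
  fix p assume p: "p \<in> cran c"
  define x where "x = cinv c p"
  have x: "x \<in> topspace X"
    using cinv_in_cdom[OF p] openin_subset[OF chart_domain_open[OF c]] by (auto simp: x_def)
  have cx: "c \<in> charts_at A x" unfolding x_def by (rule charts_at_cinv[OF c p])
  note T = coord_vec_in_tangent_space[OF cx]
  have lin: "g x (\<lambda>c. a *\<^sub>R u c + b *\<^sub>R v c) w = a * g x u w + b * g x v w"
    if "u \<in> tangent_space A x" "v \<in> tangent_space A x" "w \<in> tangent_space A x" for u v w a b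
    using riemannian x that unfolding riemannian_manifold_def by blast
  have G: "coord_metric A g c p u v = g x (coord_vec A c x u) (coord_vec A c x v)" for u v
    by (simp add: coord_metric_def x_def)
  have comb: "coord_metric A g c p (a *\<^sub>R u + b *\<^sub>R v) w =
      a * coord_metric A g c p u w + b * coord_metric A g c p v w" for u v w a b
    unfolding G coord_vec_linear[OF cx] by (rule lin[OF T T T])
  show "linear (\<lambda>u. coord_metric A g c p u v)" for v
    using comb[of 1 _ 1 _ v] comb[of _ _ 0 0 v] by (intro linearI) simp_all
  show "coord_metric A g c p u v = coord_metric A g c p v u" for u v
    unfolding G using riemannian x T unfolding riemannian_manifold_def by blast
  show "0 < coord_metric A g c p u u" if "u \<noteq> 0" for u
  proof -
    have "coord_vec A c x u \<noteq> (\<lambda>c. 0)"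
      using coord_vec_chart[OF cx, of u] that by metis
    then show ?thesis
      unfolding G using riemannian x T unfolding riemannian_manifold_def by blast
  qed
qed

end

section \<open>Geodesics and self-convexity on the manifold\<close>

locale conformal_factor = riemannian_atlas X A g
  for X :: "'a topology" and A :: "('a, 'e::euclidean_space) chart set" and g :: "('a, 'e) metric" +
  fixes \<alpha> :: "'a \<Rightarrow> real"
  assumes \<alpha>_C2: "C2_function A \<alpha>" and \<alpha>_pos: "\<forall>x\<in>topspace X. \<alpha> x > 0"
begin

abbreviation g\<^sub>\<alpha> where "g\<^sub>\<alpha> \<equiv> conformal_metric \<alpha> g"

lemma coord_metric_conformal:
  "coord_metric A g\<^sub>\<alpha> c = (\<lambda>p u v. (\<alpha> \<circ> cinv c) p * coord_metric A g c p u v)"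
  by (simp add: fun_eq_iff coord_metric_def conformal_metric_def)

lemma chart_conformal_change:
  assumes c: "c \<in> A"
  shows "conformal_change (cran c) (coord_metric A g c) (\<alpha> \<circ> cinv c)"
proof (intro conformal_change.intro conformal_change_axioms.intro)
  show "local_metric (cran c) (coord_metric A g c)" by (rule coord_metric_local_metric[OF c])
  show "Ck_on 2 (cran c) (\<alpha> \<circ> cinv c)" using \<alpha>_C2 c by (simp add: C2_function_def)
  show "0 < (\<alpha> \<circ> cinv c) p" if "p \<in> cran c" for p
    using \<alpha>_pos cinv_in_cdom[OF that] openin_subset[OF chart_domain_open[OF c]] by auto
qed

lemma chart_local_metric: "c \<in> A \<Longrightarrow> local_metric (cran c) (coord_metric A g\<^sub>\<alpha> c)"
  unfolding coord_metric_conformal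
  by (rule conformal_change.conformal_local_metric[OF chart_conformal_change])

lemma chart_change_isometry:
  assumes "c \<in> A" "d \<in> A"
  shows "metric_isometry (cran c) (coord_metric A g\<^sub>\<alpha> c) (cran d) (coord_metric A g\<^sub>\<alpha> d)
    (overlap c d) (transition c d)"
  by (intro metric_isometry.intro metric_isometry_axioms.intro chart_local_metric overlap_open
      transition_smooth coord_metric_transition assms)
    (auto simp: cinv_cmap[OF assms(1)])

text \<open>A solution of the geodesic equation in the chart \<open>c\<close> is carried to the manifold by the inverse of
  \<open>c\<close>. In any other chart that it meets its expression is the image of the solution under the
  transition map, which is an isometry of the coordinate metrics.\<close>

lemma geodesic_exists:
  assumes c: "c \<in> charts_at A x"
  obtains T \<gamma> where "T > 0" "geodesic X A g\<^sub>\<alpha> {-T<..<T} \<gamma>" "\<gamma> 0 = x"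
    "((cmap c \<circ> \<gamma>) has_vector_derivative u) (at 0)"
proof -
  have cA: "c \<in> A" and xc: "x \<in> cdom c" using c by (auto simp: charts_at_def)
  interpret H: local_metric "cran c" "coord_metric A g\<^sub>\<alpha> c" by (rule chart_local_metric[OF cA])
  have "cmap c x \<in> cran c" using xc by simp
  from H.local_geodesic_exists[OF this, of u] obtain T y y' where T: "T > 0"
    and y0: "y 0 = cmap c x" "y' 0 = u"
    and yS: "\<And>t. t \<in> {-T<..<T} \<Longrightarrow> y t \<in> cran c"
    and y: "\<And>t. t \<in> {-T<..<T} \<Longrightarrow> (y has_vector_derivative y' t) (at t)"
    and y': "\<And>t. t \<in> {-T<..<T} \<Longrightarrow> (y' has_vector_derivative
       - christoffel (coord_metric A g\<^sub>\<alpha> c) (y t) (y' t) (y' t)) (at t)"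
    by blast
  let ?I = "{-T<..<T}"
  define \<gamma> where "\<gamma> = cinv c \<circ> y"
  have "continuous_on ?I y"
    using y by (intro continuous_at_imp_continuous_on ballI) (auto intro: has_vector_derivative_continuous)
  then have "continuous_map (top_of_set ?I) (top_of_set (cran c)) y"
    using yS by (auto simp: continuous_map_in_subtopology)
  from continuous_map_compose[OF this cinv_continuous[OF cA]]
  have cont: "continuous_map (top_of_set ?I) X \<gamma>" by (simp add: \<gamma>_def)
  have geo: "(cmap d \<circ> \<gamma>) differentiable (at t)" (is ?diff)
    "((\<lambda>s. vector_derivative (cmap d \<circ> \<gamma>) (at s)) has_vector_derivative
       - christoffel (coord_metric A g\<^sub>\<alpha> d) ((cmap d \<circ> \<gamma>) t)
          (vector_derivative (cmap d \<circ> \<gamma>) (at t)) (vector_derivative (cmap d \<circ> \<gamma>) (at t))) (at t)" (is ?ode)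
    if t: "t \<in> ?I" and d: "d \<in> charts_at A (\<gamma> t)" for t d
  proof -
    have dA: "d \<in> A" using d by (simp add: charts_at_def)
    interpret iso: metric_isometry "cran c" "coord_metric A g\<^sub>\<alpha> c" "cran d" "coord_metric A g\<^sub>\<alpha> d"
      "overlap c d" "transition c d" by (rule chart_change_isometry[OF cA dA])
    define N where "N = {s \<in> ?I. \<gamma> s \<in> cdom d}"
    have "open N"
      unfolding N_def by (rule continuous_map_open_preimage[OF cont _ chart_domain_open[OF dA]]) simp
    have tN: "t \<in> N" using t d by (simp add: N_def charts_at_def)
    have overlap: "y s \<in> overlap c d" if "s \<in> N" for s
    proof -
      have "y s = cmap c (\<gamma> s)" "\<gamma> s \<in> cdom c"
        using that yS[of s] by (auto simp: \<gamma>_def N_def cmap_cinv intro: cinv_in_cdom)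
      then show ?thesis using that by (auto simp: N_def)
    qed
    have comp: "cmap d \<circ> \<gamma> = (\<lambda>s. transition c d (y s))" by (simp add: \<gamma>_def fun_eq_iff)
    have vd: "((cmap d \<circ> \<gamma>) has_vector_derivative
        frechet_derivative (transition c d) (at (y s)) (y' s)) (at s)" if "s \<in> N" for s
      unfolding comp using that
      by (intro iso.geodesic_transform(1)[OF overlap[OF that] y y']) (auto simp: N_def)
    then show ?diff using tN differentiableI_vector by blast
    have vd_eq: "frechet_derivative (transition c d) (at (y s)) (y' s) =
        vector_derivative (cmap d \<circ> \<gamma>) (at s)" if "s \<in> N" for s
      using vector_derivative_at[OF vd[OF that]] by simp
    show ?ode
      using has_vector_derivative_transform_within_open[OF
          iso.geodesic_transform(2)[OF overlap[OF tN] y[OF t] y'[OF t]] \<open>open N\<close> tN vd_eq]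
      by (simp add: vd_eq[OF tN] comp)
  qed
  have "geodesic X A g\<^sub>\<alpha> ?I \<gamma>"
    unfolding geodesic_def Let_def
    by (intro conjI ballI cont geo) (auto simp: is_interval_convex_1)
  moreover have "\<gamma> 0 = x" by (simp add: \<gamma>_def y0 cinv_cmap[OF cA xc])
  moreover have "((cmap c \<circ> \<gamma>) has_vector_derivative u) (at 0)"
    by (rule has_vector_derivative_transform_within_open[of y _ _ ?I])
      (use T y[of 0] y0 in \<open>auto simp: \<gamma>_def cmap_cinv[OF yS]\<close>)
  ultimately show ?thesis using that T by blast
qed

definition convexity_form where
  "convexity_form x v = 2 * \<alpha> x * hessian A g \<alpha> x v v
     + (dual_norm A g x (differential A \<alpha> x))\<^sup>2 * (metric_norm g x v)\<^sup>2
     - 4 * (differential A \<alpha> x v)\<^sup>2"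

text \<open>The chart identifies the unit ball of the tangent space with that of the coordinate metric.\<close>

lemma dual_norm_eq_norm_gradient:
  assumes x: "x \<in> topspace X"
  defines "c \<equiv> chart_at A x"
  assumes n: "\<And>z. coord_metric A g c (cmap c x) n z = frechet_derivative (\<alpha> \<circ> cinv c) (at (cmap c x)) z"
  shows "dual_norm A g x (differential A \<alpha> x) = sqrt (coord_metric A g c (cmap c x) n n)"
proof -
  have c: "c \<in> charts_at A x" unfolding c_def by (rule chart_at_in_charts_at[OF x])
  then have cA: "c \<in> A" and xc: "x \<in> cdom c" by (auto simp: charts_at_def)
  interpret local_metric "cran c" "coord_metric A g c" by (rule coord_metric_local_metric[OF cA])
  have G: "coord_metric A g c (cmap c x) u v = g x (coord_vec A c x u) (coord_vec A c x v)" for u v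
    by (simp add: coord_metric_def cinv_cmap[OF cA xc])
  have ball: "{v \<in> tangent_space A x. metric_norm g x v \<le> 1} =
      coord_vec A c x ` {z. sqrt (coord_metric A g c (cmap c x) z z) \<le> 1}"
  proof (intro equalityI subsetI)
    fix v assume "v \<in> {v \<in> tangent_space A x. metric_norm g x v \<le> 1}"
    then show "v \<in> coord_vec A c x ` {z. sqrt (coord_metric A g c (cmap c x) z z) \<le> 1}"
      by (intro image_eqI[of _ _ "v c"]) (auto simp: coord_vec_tangent[OF c] G metric_norm_def)
  qed (auto simp: G metric_norm_def coord_vec_in_tangent_space[OF c])
  have "dual_norm A g x (differential A \<alpha> x) =
      (SUP z\<in>{z. sqrt (coord_metric A g c (cmap c x) z z) \<le> 1}. \<bar>coord_metric A g c (cmap c x) n z\<bar>)"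
    unfolding dual_norm_def ball image_image
    by (simp add: differential_def Let_def coord_vec_chart[OF c] n flip: c_def)
  also have "\<dots> = sqrt (coord_metric A g c (cmap c x) n n)"
    by (rule operator_norm_eq_norm_gradient) (use xc in simp)
  finally show ?thesis .
qed

text \<open>The derivative of \<open>ln \<circ> \<alpha> \<circ> \<gamma>\<close> has the expression \<open>Da(y)(y') / a(y)\<close> only as long as \<open>\<gamma>\<close> stays in the chart, and
  the chart used in \<open>hessian\<close> and \<open>differential\<close> may change along \<open>\<gamma>\<close>. The second derivative is
  therefore stated for \<open>deriv f\<close>, which is independent of charts, and computed at \<open>t\<close> in the chart
  chosen for \<open>\<gamma> t\<close>.\<close>

lemma ln_along_geodesic:
  assumes geo: "geodesic X A g\<^sub>\<alpha> I \<gamma>" and t: "t \<in> I"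
  defines "x \<equiv> \<gamma> t"
  defines "v \<equiv> coord_vec A (chart_at A x) x (vector_derivative (cmap (chart_at A x) \<circ> \<gamma>) (at t))"
  defines "f \<equiv> \<lambda>s. ln (\<alpha> (\<gamma> s))"
  shows "x \<in> topspace X" and "v \<in> tangent_space A x"
    and "(f has_real_derivative deriv f t) (at t)"
    and "(deriv f has_real_derivative convexity_form x v / (2 * (\<alpha> x)\<^sup>2)) (at t)"
proof -
  have "open I" and cont: "continuous_map (top_of_set I) X \<gamma>"
    using geo by (auto simp: geodesic_def)
  show x: "x \<in> topspace X"
    using continuous_map_image_subset_topspace[OF cont] t by (auto simp: x_def)
  define c where "c = chart_at A x"
  have c: "c \<in> charts_at A x" unfolding c_def by (rule chart_at_in_charts_at[OF x])
  then have cA: "c \<in> A" and xc: "x \<in> cdom c" by (auto simp: charts_at_def)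
  show "v \<in> tangent_space A x"
    unfolding v_def c_def[symmetric] by (rule coord_vec_in_tangent_space[OF c])
  let ?G = "coord_metric A g c" and ?a = "\<alpha> \<circ> cinv c"
  interpret conformal_change "cran c" ?G ?a by (rule chart_conformal_change[OF cA])
  define y where "y = cmap c \<circ> \<gamma>"
  define y' where "y' s = vector_derivative y (at s)" for s
  define N where "N = {s \<in> I. \<gamma> s \<in> cdom c}"
  have "open N"
    unfolding N_def by (rule continuous_map_open_preimage[OF cont \<open>open I\<close> chart_domain_open[OF cA]])
  have tN: "t \<in> N" using t xc by (simp add: N_def x_def)
  have eqn: "y s \<in> cran c" "(y has_vector_derivative y' s) (at s)"
    "(y' has_vector_derivative - christoffel (coord_metric A g\<^sub>\<alpha> c) (y s) (y' s) (y' s)) (at s)"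
    if "s \<in> N" for s
  proof -
    have "s \<in> I" "c \<in> charts_at A (\<gamma> s)" using that cA by (auto simp: N_def charts_at_def)
    then have "y differentiable (at s)"
      "((\<lambda>r. vector_derivative y (at r)) has_vector_derivative
         - christoffel (coord_metric A g\<^sub>\<alpha> c) (y s) (vector_derivative y (at s)) (vector_derivative y (at s))) (at s)"
      using geo unfolding geodesic_def Let_def y_def by blast+
    then show "(y has_vector_derivative y' s) (at s)"
      "(y' has_vector_derivative - christoffel (coord_metric A g\<^sub>\<alpha> c) (y s) (y' s) (y' s)) (at s)"
      by (simp_all add: y'_def[abs_def] vector_derivative_works)
    show "y s \<in> cran c" using that by (simp add: N_def y_def)
  qed
  have \<alpha>_y: "?a (y s) = \<alpha> (\<gamma> s)" if "s \<in> N" for s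
    using that by (simp add: N_def y_def cinv_cmap[OF cA])
  have grad: "\<exists>n. \<forall>z. ?G p n z = frechet_derivative ?a (at p) z" if "p \<in> cran c" for p
    by (rule G_represents[OF that has_derivative_linear[OF a_has_derivative[OF that]]])
  define f' where "f' s = frechet_derivative ?a (at (y s)) (y' s) / ?a (y s)" for s
  have f': "(f has_real_derivative f' s) (at s)" if s: "s \<in> N" for s
  proof -
    obtain n where n: "\<And>z. ?G (y s) n z = frechet_derivative ?a (at (y s)) z"
      using grad[OF eqn(1)[OF s]] by blast
    have "((\<lambda>s. ln (?a (y s))) has_real_derivative f' s) (at s)"
      unfolding f'_def
      by (rule ln_second_derivative_along_geodesic(1)[where y' = y', OF eqn(1)[OF s] n eqn(2)[OF s]
            eqn(3)[OF s, unfolded coord_metric_conformal]])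
    then show ?thesis
      unfolding has_field_derivative_def
      by (rule has_derivative_transform_within_open[OF _ \<open>open N\<close> s])
        (simp add: f_def \<alpha>_y[unfolded o_def])
  qed
  have deriv_f: "f' s = deriv f s" if "s \<in> N" for s
    using DERIV_imp_deriv[OF f'[OF that]] by simp
  show "(f has_real_derivative deriv f t) (at t)"
    using f'[OF tN] deriv_f[OF tN] by simp
  have yt: "y t = cmap c x" by (simp add: y_def x_def)
  obtain n where n: "\<And>z. ?G (y t) n z = frechet_derivative ?a (at (y t)) z"
    using grad[OF eqn(1)[OF tN]] by blast
  have vc: "v c = y' t" and v: "v = coord_vec A c x (y' t)"
    using coord_vec_chart[OF c] by (simp_all add: v_def y'_def y_def flip: c_def)
  have dual: "(dual_norm A g x (differential A \<alpha> x))\<^sup>2 = ?G (y t) n n"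
    using dual_norm_eq_norm_gradient[OF x, folded c_def, OF n[unfolded yt]]
      G_nonneg[OF eqn(1)[OF tN], of n] by (simp add: yt)
  have norm: "(metric_norm g x v)\<^sup>2 = ?G (y t) (y' t) (y' t)"
    using G_nonneg[OF eqn(1)[OF tN], of "y' t"]
    by (simp add: metric_norm_def v yt coord_metric_def cinv_cmap[OF cA xc])
  have "(f' has_real_derivative convexity_form x v / (2 * (\<alpha> x)\<^sup>2)) (at t)"
    using ln_second_derivative_along_geodesic(2)[where y' = y', OF eqn(1)[OF tN] n eqn(2)[OF tN]
        eqn(3)[OF tN, unfolded coord_metric_conformal]]
    unfolding convexity_form_def dual norm hessian_def differential_def Let_def c_def[symmetric]
      vc yt[symmetric] f'_def[abs_def] \<alpha>_y[OF tN] x_def[symmetric] .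
  then show "(deriv f has_real_derivative convexity_form x v / (2 * (\<alpha> x)\<^sup>2)) (at t)"
    unfolding has_field_derivative_def
    by (rule has_derivative_transform_within_open[OF _ \<open>open N\<close> tN deriv_f])
qed

theorem self_convex_iff:
  "self_convex X A g \<alpha> \<longleftrightarrow> (\<forall>x\<in>topspace X. \<forall>v\<in>tangent_space A x. convexity_form x v \<ge> 0)"
proof (intro iffI ballI)
  fix x v assume sc: "self_convex X A g \<alpha>" and x: "x \<in> topspace X" and v: "v \<in> tangent_space A x"
  define c where "c = chart_at A x"
  have c: "c \<in> charts_at A x" unfolding c_def by (rule chart_at_in_charts_at[OF x])
  obtain T \<gamma> where T: "T > 0" and geo: "geodesic X A g\<^sub>\<alpha> {-T<..<T} \<gamma>" and \<gamma>: "\<gamma> 0 = x"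
    "((cmap c \<circ> \<gamma>) has_vector_derivative v c) (at 0)"
    using geodesic_exists[OF c] by blast
  have "0 \<in> {-T<..<T}" using T by simp
  note second = ln_along_geodesic(4)[OF geo this, unfolded \<gamma>(1), folded c_def,
      unfolded vector_derivative_at[OF \<gamma>(2)] coord_vec_tangent[OF c v]]
  have "convex_on {-T<..<T} (\<lambda>t. ln (\<alpha> (\<gamma> t)))"
    using sc geo unfolding self_convex_def by blast
  then have "0 \<le> convexity_form x v / (2 * (\<alpha> x)\<^sup>2)"
    using convex_on_second_derivative_nonneg[OF _ open_greaterThanLessThan \<open>0 \<in> {-T<..<T}\<close>
        ln_along_geodesic(3)[OF geo] second] by blast
  then show "convexity_form x v \<ge> 0"
    using \<alpha>_pos x by (force simp: zero_le_divide_iff)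
next
  assume nonneg: "\<forall>x\<in>topspace X. \<forall>v\<in>tangent_space A x. convexity_form x v \<ge> 0"
  show "self_convex X A g \<alpha>"
    unfolding self_convex_def
  proof (intro allI impI)
    fix I \<gamma> assume geo: "geodesic X A g\<^sub>\<alpha> I \<gamma>"
    then have "convex I" by (simp add: geodesic_def is_interval_convex_1)
    then show "convex_on I (\<lambda>t. ln (\<alpha> (\<gamma> t)))"
    proof (rule f''_ge0_imp_convex[OF _ ln_along_geodesic(3)[OF geo] ln_along_geodesic(4)[OF geo]])
      fix t assume t: "t \<in> I"
      show "0 \<le> convexity_form (\<gamma> t) (coord_vec A (chart_at A (\<gamma> t)) (\<gamma> t)
          (vector_derivative (cmap (chart_at A (\<gamma> t)) \<circ> \<gamma>) (at t))) / (2 * (\<alpha> (\<gamma> t))\<^sup>2)"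
        using nonneg ln_along_geodesic(1,2)[OF geo t] by auto
    qed
  qed
qed

end

theorem proposition2:
  fixes X :: "'a topology"
    and A :: "('a, 'e::euclidean_space) chart set"
    and g :: "('a, 'e) metric"
    and \<alpha> :: "'a \<Rightarrow> real"
  assumes "riemannian_manifold X A g"
    and "C2_function A \<alpha>"
    and "\<forall>x\<in>topspace X. \<alpha> x > 0"
  shows "self_convex X A g \<alpha> \<longleftrightarrow>
    (\<forall>x\<in>topspace X. \<forall>v\<in>tangent_space A x.
       2 * \<alpha> x * hessian A g \<alpha> x v v
       + (dual_norm A g x (differential A \<alpha> x))\<^sup>2 * (metric_norm g x v)\<^sup>2
       - 4 * (differential A \<alpha> x v)\<^sup>2 \<ge> 0)"
proof -
  interpret conformal_factor X A g \<alpha>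
    using assms by unfold_locales
  show ?thesis
    using self_convex_iff unfolding convexity_form_def .
qed

end
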